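(* Let $\mathcal M$ be an expansion of an ordered group such that the first-order theory $\mathrm{Th}(\mathcal M)$ is decidable. Let $\mathcal C$ be a class of $\mathcal M$-games such that for every $\mathcal A=(\mathcal M,Q,\mathrm{Goal},\Sigma,\delta,\gamma)$ in $\mathcal C$ there exists a finite partition $\mathcal P$ of $Q\times V_2$, definable in $\mathcal M$, such that $\mathrm{Goal}\times V_2$ is a union of pieces of $\mathcal P$, $\mathcal P$ is suffix-stable, and $\mathcal P$ is stable under $\mathrm{Pred}_a$ for every action $a\in\Sigma$. Then the control problem under perfect observation in the class $\mathcal C$ is decidable, and for every $\mathcal A\in\mathcal C$ the set of winning states of $\mathcal A$ under perfect observation is computable.
   Context: $\mathcal M=\langle M,+,0,1,<,\dots\rangle$ is an expansion of an ordered group with $0<1$; "definable" = first-order definable in $\mathcal M$ (a partition is definable if each piece is); $M^+=\{\tau\in M\mid\tau\ge0\}$. Fix $V_1\subseteq M^{k_1}$, $V\subseteq M$, $V_2\subseteq M^{k_2}$. An $\mathcal M$-game is a tuple $\mathcal A=(\mathcal M,Q,\mathrm{Goal},\Sigma,\delta,\gamma)$: $Q$ finite set of locations, $\mathrm{Goal}\subseteq Q$, $\Sigma$ finite set of actions partitioned into controllable $\Sigma_c$ and uncontrollable $\Sigma_u$, $\delta$ finite set of transitions $(q,g,a,R,q')$ with $g\subseteq V_2$ and $R:V_2\to2^{V_2}$ definable, and $\gamma$ maps each location $q$ to a definable $\gamma_q:V_1\times V\to V_2$. Discrete transitions: $(q,y)\xrightarrow{a}(q',y')$ iff some $(q,g,a,R,q')\in\delta$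 has $y\in g$, $y'\in R(y)$. $(q,x,t,y)\xrightarrow{\tau}(q,x,t+\tau,y')$ ($\tau\in M^+$) iff $\gamma_q(x,t)=y$, $\gamma_q(x,t+\tau)=y'$; $(q,x,t,y)\xrightarrow{\tau,a}(q'',x'',t'',y'')$ if $(q,x,t,y)\xrightarrow{\tau}(q,x,t+\tau,y')$, $(q,y')\xrightarrow{a}(q'',y'')$ and $\gamma_{q''}(x'',t'')=y''$, and then $(\tau,a)$ is enabled in $(q,x,t,y)$. Runs $(q_0,x_0,t_0,y_0)\xrightarrow{\tau_1,a_1}(q_1,x_1,t_1,y_1)\cdots$ are winning if some $q_i\in\mathrm{Goal}$. A strategy is a partial map $\lambda$ from finite runs to $M^+\times\Sigma_c$ whose value, when defined, is enabled in the last state. A run is consistent with $\lambda$ if for each prefix $\rho_i$ with $\lambda(\rho_i)=(\tau,a)$ either $(\tau_{i+1},a_{i+1})=(\tau,a)$ or $\tau_{i+1}\le\tau$ and $a_{i+1}\in\Sigma_u$; maximal if infinite or $\lambda$ undefined on it. $\lambda$ is winning from $(q,y)$ if for every $(x,t)$ with $\gamma_q(x,t)=y$ every maximal run from $(q,x,t,y)$ consistent with $\lambda$ is winning; winning states under perfect observation are states from which some strategy is winning. Control problem under perfect observation in $\mathcal C$: given $\mathcal A\in\mathcal C$ and a definable state $(q,y)$, decide whether a winning strategy from $(q,y)$ exists. "Computable" set: a defining first-order formula can be computed. $\mathrm{Pred}_a(W)$ ($W\subseteq Q\times V_2$) is the set of $(q,y)$ having at least one $a$-successor and all of whose $a$-successors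 lie in $W$; $\mathcal P$ is stable under $\mathrm{Pred}_a$ if $\mathrm{Pred}_a(W)$ is a union of pieces whenever $W$ is. Suffixes: for a location $q$ and $x\in V_1$, let $\mathcal F^q_x$ be the set of time intervals or points $I\subseteq V$ that are maximal for the property "there is $P\in\mathcal P$ with $(q,\gamma_q(x,t))\in P$ for all $t\in I$", ordered by the order of $M$; for $t\in V$ let $\mathcal F^q_{(x,t)}=\{I\cap\{t'\in V\mid t'\ge t\}\mid I\in\mathcal F^q_x\}$ (nonempty ones), and $\omega^q_{(x,t)}$ the word over $\mathcal P$ listing, along these ordered intervals, the piece containing $(q,\gamma_q(x,t'))$ for $t'$ in the interval. The suffix abstraction is $\mathrm{Suf}_{\mathcal P}(q,y)=\{\omega^q_{(x,t)}\mid\gamma_q(x,t)=y\}$. $\mathrm{Suf}(\mathcal P)$ is the partition where $(q,y),(q',y')$ are equivalent iff $q=q'$ and $\mathrm{Suf}_{\mathcal P}(q,y)=\mathrm{Suf}_{\mathcal P}(q',y')$; $\mathcal P$ is suffix-stable if $\mathrm{Suf}(\mathcal P)=\mathcal P$. *)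

theory Defs
  imports Complex_Main "HOL-Library.Nat_Bijection" "HOL-Library.Disjoint_Sets"
begin

section \<open>Partial recursive functions\<close>

text \<open>The first argument of \<open>PrimRec f g\<close> is the recursion variable; \<open>Mu f\<close> searches for the
  least zero of \<open>f\<close> in its first argument.\<close>

datatype recf = ZeroF | SuccF | Proj nat | Comp recf "recf list" | PrimRec recf recf | Mu recf

inductive computes :: "recf \<Rightarrow> nat list \<Rightarrow> nat \<Rightarrow> bool" where
  zero: "computes ZeroF xs 0"
| succ: "computes SuccF (x # xs) (Suc x)"
| proj: "i < length xs \<Longrightarrow> computes (Proj i) xs (xs ! i)"
| comp: "list_all2 (\<lambda>g y. computes g xs y) gs ys \<Longrightarrow> computes f ys z \<Longrightarrow> computes (Comp f gs) xs z"
| prim_0: "computes f xs z \<Longrightarrow> computes (PrimRec f g) (0 # xs) z"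
| prim_Suc: "computes (PrimRec f g) (n # xs) y \<Longrightarrow> computes g (n # y # xs) z \<Longrightarrow>
    computes (PrimRec f g) (Suc n # xs) z"
| mu: "computes f (n # xs) 0 \<Longrightarrow> (\<forall>m<n. \<exists>k. computes f (m # xs) (Suc k)) \<Longrightarrow>
    computes (Mu f) xs n"

inductive_cases computes_ZeroE: "computes ZeroF xs z"
inductive_cases computes_SuccE: "computes SuccF xs z"
inductive_cases computes_ProjE: "computes (Proj i) xs z"
inductive_cases computes_CompE: "computes (Comp f gs) xs z"
inductive_cases computes_Prim0E: "computes (PrimRec f g) (0 # xs) z"
inductive_cases computes_PrimSucE: "computes (PrimRec f g) (Suc n # xs) z"
inductive_cases computes_MuE: "computes (Mu f) xs z"

lemma computes_deterministic: "computes f xs y \<Longrightarrow> computes f xs z \<Longrightarrow> y = z"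
proof (induction arbitrary: z rule: computes.induct)
  case (zero xs)
  then show ?case by (rule computes_ZeroE) simp
next
  case (succ x xs)
  then show ?case by (rule computes_SuccE) simp
next
  case (proj i xs)
  from proj.prems show ?case by (rule computes_ProjE) simp
next
  case (comp xs gs ys f y)
  from comp.prems obtain ys' where ys': "list_all2 (\<lambda>g y. computes g xs y) gs ys'" "computes f ys' z"
    by (rule computes_CompE)
  have "length ys = length ys'"
    using comp.IH(1) ys'(1) by (simp add: list_all2_lengthD[symmetric])
  moreover have "ys ! i = ys' ! i" if "i < length ys" for i
    using list_all2_nthD2[OF comp.IH(1) that] list_all2_nthD2[OF ys'(1), of i] that \<open>length ys = length ys'\<close>
    by simp
  ultimately have "ys = ys'" by (rule nth_equalityI)
  then show ?case using comp.IH(2) ys'(2) by simp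
next
  case (prim_0 f xs y g)
  from prim_0.prems have "computes f xs z" by (rule computes_Prim0E)
  then show ?case by (rule prim_0.IH)
next
  case (prim_Suc f g n xs y z')
  from prim_Suc.prems obtain y' where "computes (PrimRec f g) (n # xs) y'" "computes g (n # y' # xs) z"
    by (rule computes_PrimSucE)
  then show ?case using prim_Suc.IH by metis
next
  case (mu f n xs)
  from mu.prems have z1: "computes f (z # xs) 0" by (rule computes_MuE)
  from mu.prems have z2: "\<forall>m<z. \<exists>k. computes f (m # xs) (Suc k)" by (rule computes_MuE)
  show ?case
  proof (cases n z rule: linorder_cases)
    assume "n < z"
    then obtain k where "computes f (n # xs) (Suc k)" using z2 by blast
    then have "0 = Suc k" by (rule mu.IH(1))
    then show ?thesis by simp
  next
    assume "z < n"
    then obtain k where "\<forall>w. computes f (z # xs) w \<longrightarrow> Suc k = w" using mu.IH(2) by blast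
    then have "Suc k = 0" using z1 by blast
    then show ?thesis by simp
  qed
qed

definition decidable_set :: "nat set \<Rightarrow> bool" where
  "decidable_set S \<longleftrightarrow> (\<exists>f. \<forall>n. computes f [n] (if n \<in> S then 1 else 0))"

section \<open>First-order logic over expansions of ordered groups\<close>

text \<open>Linearly ordered, not necessarily commutative, groups with a distinguished positive
  element \<open>1\<close>.\<close>

class ordered_grp = group_add + linorder + zero_less_one +
  assumes grp_add_left_mono: "a \<le> b \<Longrightarrow> c + a \<le> c + b"
    and grp_add_right_mono: "a \<le> b \<Longrightarrow> a + c \<le> b + c"

text \<open>The symbols \<open>+, 0, 1, <\<close> are built in; all further symbols are named by natural numbers
  (a decidable theory presupposes a countable language).\<close>

datatype tm = Var nat | Zero | One | Plus tm tm | Fun nat "tm list"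

datatype fm = Eq tm tm | Less tm tm | Rel nat "tm list" | Neg fm | Conj fm fm | Ex nat fm

text \<open>A pair \<open>(s, n)\<close> in \<open>fun_syms\<close> or \<open>rel_syms\<close> is a symbol \<open>s\<close> of arity \<open>n\<close> of the language.\<close>

record 'm fo_struct =
  fun_syms :: "(nat \<times> nat) set"
  rel_syms :: "(nat \<times> nat) set"
  fun_int :: "nat \<Rightarrow> 'm list \<Rightarrow> 'm"
  rel_int :: "nat \<Rightarrow> 'm list \<Rightarrow> bool"

primrec wf_tm :: "'m fo_struct \<Rightarrow> tm \<Rightarrow> bool" where
  "wf_tm M (Var i) \<longleftrightarrow> True"
| "wf_tm M Zero \<longleftrightarrow> True"
| "wf_tm M One \<longleftrightarrow> True"
| "wf_tm M (Plus s t) \<longleftrightarrow> wf_tm M s \<and> wf_tm M t"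
| "wf_tm M (Fun f ts) \<longleftrightarrow> (f, length ts) \<in> fun_syms M \<and> list_all (wf_tm M) ts"

primrec wf_fm :: "'m fo_struct \<Rightarrow> fm \<Rightarrow> bool" where
  "wf_fm M (Eq s t) \<longleftrightarrow> wf_tm M s \<and> wf_tm M t"
| "wf_fm M (Less s t) \<longleftrightarrow> wf_tm M s \<and> wf_tm M t"
| "wf_fm M (Rel r ts) \<longleftrightarrow> (r, length ts) \<in> rel_syms M \<and> list_all (wf_tm M) ts"
| "wf_fm M (Neg \<phi>) \<longleftrightarrow> wf_fm M \<phi>"
| "wf_fm M (Conj \<phi> \<psi>) \<longleftrightarrow> wf_fm M \<phi> \<and> wf_fm M \<psi>"
| "wf_fm M (Ex i \<phi>) \<longleftrightarrow> wf_fm M \<phi>"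

primrec fv_tm :: "tm \<Rightarrow> nat set" where
  "fv_tm (Var i) = {i}"
| "fv_tm Zero = {}"
| "fv_tm One = {}"
| "fv_tm (Plus s t) = fv_tm s \<union> fv_tm t"
| "fv_tm (Fun f ts) = \<Union> (set (map fv_tm ts))"

primrec fv_fm :: "fm \<Rightarrow> nat set" where
  "fv_fm (Eq s t) = fv_tm s \<union> fv_tm t"
| "fv_fm (Less s t) = fv_tm s \<union> fv_tm t"
| "fv_fm (Rel r ts) = \<Union> (set (map fv_tm ts))"
| "fv_fm (Neg \<phi>) = fv_fm \<phi>"
| "fv_fm (Conj \<phi> \<psi>) = fv_fm \<phi> \<union> fv_fm \<psi>"
| "fv_fm (Ex i \<phi>) = fv_fm \<phi> - {i}"

primrec val :: "'m::ordered_grp fo_struct \<Rightarrow> (nat \<Rightarrow> 'm) \<Rightarrow> tm \<Rightarrow> 'm" where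
  "val M e (Var i) = e i"
| "val M e Zero = 0"
| "val M e One = 1"
| "val M e (Plus s t) = val M e s + val M e t"
| "val M e (Fun f ts) = fun_int M f (map (val M e) ts)"

primrec sat :: "'m::ordered_grp fo_struct \<Rightarrow> (nat \<Rightarrow> 'm) \<Rightarrow> fm \<Rightarrow> bool" where
  "sat M e (Eq s t) \<longleftrightarrow> val M e s = val M e t"
| "sat M e (Less s t) \<longleftrightarrow> val M e s < val M e t"
| "sat M e (Rel r ts) \<longleftrightarrow> rel_int M r (map (val M e) ts)"
| "sat M e (Neg \<phi>) \<longleftrightarrow> \<not> sat M e \<phi>"
| "sat M e (Conj \<phi> \<psi>) \<longleftrightarrow> sat M e \<phi> \<and> sat M e \<psi>"
| "sat M e (Ex i \<phi>) \<longleftrightarrow> (\<exists>a. sat M (e(i := a)) \<phi>)"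

definition Th :: "'m::ordered_grp fo_struct \<Rightarrow> fm set" where
  "Th M = {\<phi>. wf_fm M \<phi> \<and> fv_fm \<phi> = {} \<and> (\<forall>e. sat M e \<phi>)}"

text \<open>\<open>M\<^sup>k\<close> consists of the lists of length \<open>k\<close>; the variable \<open>i\<close> of a defining formula stands for
  the \<open>i\<close>-th coordinate (from \<open>0\<close>). Definability is without parameters.\<close>

definition fm_defines :: "'m::ordered_grp fo_struct \<Rightarrow> fm \<Rightarrow> nat \<Rightarrow> 'm list set \<Rightarrow> bool" where
  "fm_defines M \<phi> k S \<longleftrightarrow> wf_fm M \<phi> \<and> fv_fm \<phi> \<subseteq> {..<k} \<and> S = {xs. length xs = k \<and> sat M ((!) xs) \<phi>}"

definition definable :: "'m::ordered_grp fo_struct \<Rightarrow> nat \<Rightarrow> 'm list set \<Rightarrow> bool" where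
  "definable M k S \<longleftrightarrow> (\<exists>\<phi>. fm_defines M \<phi> k S)"

primrec tm_code :: "tm \<Rightarrow> nat" where
  "tm_code (Var i) = prod_encode (0, i)"
| "tm_code Zero = prod_encode (1, 0)"
| "tm_code One = prod_encode (1, 1)"
| "tm_code (Plus s t) = prod_encode (2, prod_encode (tm_code s, tm_code t))"
| "tm_code (Fun f ts) = prod_encode (3, prod_encode (f, list_encode (map tm_code ts)))"

primrec fm_code :: "fm \<Rightarrow> nat" where
  "fm_code (Eq s t) = prod_encode (0, prod_encode (tm_code s, tm_code t))"
| "fm_code (Less s t) = prod_encode (1, prod_encode (tm_code s, tm_code t))"
| "fm_code (Rel r ts) = prod_encode (2, prod_encode (r, list_encode (map tm_code ts)))"
| "fm_code (Neg \<phi>) = prod_encode (3, fm_code \<phi>)"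
| "fm_code (Conj \<phi> \<psi>) = prod_encode (4, prod_encode (fm_code \<phi>, fm_code \<psi>))"
| "fm_code (Ex i \<phi>) = prod_encode (5, prod_encode (i, fm_code \<phi>))"

lemma tm_code_inject: "tm_code s = tm_code t \<longleftrightarrow> s = t"
proof (induction s arbitrary: t)
  case (Fun f ts)
  show ?case
  proof (cases t)
    case (Fun g us)
    have "map tm_code ts = map tm_code us \<longleftrightarrow> ts = us"
      using Fun.IH by (auto simp: list_eq_iff_nth_eq)
    then show ?thesis using Fun by (auto simp: list_encode_eq)
  qed auto
qed (case_tac t; auto)+

lemma fm_code_inject: "fm_code \<phi> = fm_code \<psi> \<longleftrightarrow> \<phi> = \<psi>"
proof (induction \<phi> arbitrary: \<psi>)
  case (Rel r ts)
  have "inj tm_code" by (simp add: inj_def tm_code_inject)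
  then show ?case by (cases \<psi>) (auto simp: inj_map_eq_map list_encode_eq)
qed (case_tac \<psi>; auto simp: tm_code_inject)+

definition decidable_theory :: "'m::ordered_grp fo_struct \<Rightarrow> bool" where
  "decidable_theory M \<longleftrightarrow> decidable_set (fm_code ` Th M)"

section \<open>Games\<close>

text \<open>Locations and actions are named by natural numbers. Resets are maps on \<open>V\<^sub>2\<close> and the dynamics
  of a location is a map on \<open>V\<^sub>1 \<times> V\<close>; their values elsewhere are irrelevant.\<close>

type_synonym 'm transition = "nat \<times> 'm list set \<times> nat \<times> ('m list \<Rightarrow> 'm list set) \<times> nat"

record 'm game =
  locs :: "nat set"
  goal :: "nat set"
  ctrl :: "nat set"
  unctrl :: "nat set"
  transitions :: "'m transition set"
  dyn :: "nat \<Rightarrow> 'm list \<Rightarrow> 'm \<Rightarrow> 'm list"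

definition actions :: "'m game \<Rightarrow> nat set" where
  "actions A = ctrl A \<union> unctrl A"

definition reset_graph :: "'m list set \<Rightarrow> ('m list \<Rightarrow> 'm list set) \<Rightarrow> 'm list set" where
  "reset_graph V2 R = {y @ y' | y y'. y \<in> V2 \<and> y' \<in> R y}"

definition dyn_graph :: "'m list set \<Rightarrow> 'm set \<Rightarrow> ('m list \<Rightarrow> 'm \<Rightarrow> 'm list) \<Rightarrow> 'm list set" where
  "dyn_graph V1 V f = {x @ t # f x t | x t. x \<in> V1 \<and> t \<in> V}"

definition is_game :: "'m::ordered_grp fo_struct \<Rightarrow> nat \<Rightarrow> nat \<Rightarrow> 'm list set \<Rightarrow> 'm set \<Rightarrow> 'm list set \<Rightarrow>
    'm game \<Rightarrow> bool" where
  "is_game M k1 k2 V1 V V2 A \<longleftrightarrow>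
    finite (locs A) \<and> goal A \<subseteq> locs A \<and>
    finite (ctrl A) \<and> finite (unctrl A) \<and> ctrl A \<inter> unctrl A = {} \<and>
    finite (transitions A) \<and>
    (\<forall>(q, g, a, R, q') \<in> transitions A. q \<in> locs A \<and> a \<in> actions A \<and> q' \<in> locs A \<and>
      g \<subseteq> V2 \<and> definable M k2 g \<and>
      (\<forall>y\<in>V2. R y \<subseteq> V2) \<and> definable M (k2 + k2) (reset_graph V2 R)) \<and>
    (\<forall>q\<in>locs A. (\<forall>x\<in>V1. \<forall>t\<in>V. dyn A q x t \<in> V2) \<and>
      definable M (k1 + 1 + k2) (dyn_graph V1 V (dyn A q)))"

definition disc_step :: "'m game \<Rightarrow> nat \<times> 'm list \<Rightarrow> nat \<Rightarrow> nat \<times> 'm list \<Rightarrow> bool" where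
  "disc_step A = (\<lambda>(q, y) a (q', y'). \<exists>g R. (q, g, a, R, q') \<in> transitions A \<and> y \<in> g \<and> y' \<in> R y)"

type_synonym 'm state = "nat \<times> 'm list \<times> 'm \<times> 'm list"
type_synonym 'm move = "'m \<times> nat"
type_synonym 'm fin_run = "'m state \<times> ('m move \<times> 'm state) list"
type_synonym 'm strategy = "'m fin_run \<Rightarrow> 'm move option"

datatype 'm run = FinRun "'m fin_run" | InfRun "'m state" "nat \<Rightarrow> 'm move \<times> 'm state"

fun last_state :: "'m fin_run \<Rightarrow> 'm state" where
  "last_state (s, es) = (if es = [] then s else snd (last es))"

fun first_state :: "'m run \<Rightarrow> 'm state" where
  "first_state (FinRun (s, es)) = s"
| "first_state (InfRun s e) = s"

fun states_of :: "'m run \<Rightarrow> 'm state set" where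
  "states_of (FinRun (s, es)) = insert s (snd ` set es)"
| "states_of (InfRun s e) = insert s (snd ` range e)"

text \<open>Each proper finite prefix of the run together with the move and the state that follow it.\<close>

fun steps_of :: "'m run \<Rightarrow> ('m fin_run \<times> 'm move \<times> 'm state) set" where
  "steps_of (FinRun (s, es)) = {((s, take i es), es ! i) | i. i < length es}"
| "steps_of (InfRun s e) = {((s, map e [0..<i]), e i) | i. True}"

context
  fixes V1 :: "'m::ordered_grp list set" and V :: "'m set" and V2 :: "'m list set" and A :: "'m game"
begin

definition is_state :: "'m state \<Rightarrow> bool" where
  "is_state = (\<lambda>(q, x, t, y). q \<in> locs A \<and> x \<in> V1 \<and> t \<in> V \<and> dyn A q x t = y)"

definition time_step :: "'m state \<Rightarrow> 'm \<Rightarrow> 'm state \<Rightarrow> bool" where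
  "time_step = (\<lambda>(q, x, t, y) \<tau> (q', x', t', y').
    0 \<le> \<tau> \<and> q' = q \<and> x' = x \<and> t' = t + \<tau> \<and> is_state (q, x, t, y) \<and> is_state (q, x, t + \<tau>, y'))"

definition game_step :: "'m state \<Rightarrow> 'm move \<Rightarrow> 'm state \<Rightarrow> bool" where
  "game_step = (\<lambda>(q, x, t, y) (\<tau>, a) (q'', x'', t'', y'').
    \<exists>y'. time_step (q, x, t, y) \<tau> (q, x, t + \<tau>, y') \<and>
      disc_step A (q, y') a (q'', y'') \<and> is_state (q'', x'', t'', y''))"

definition enabled :: "'m move \<Rightarrow> 'm state \<Rightarrow> bool" where
  "enabled m s \<longleftrightarrow> (\<exists>s'. game_step s m s')"

definition is_run :: "'m run \<Rightarrow> bool" where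
  "is_run \<rho> \<longleftrightarrow> is_state (first_state \<rho>) \<and>
    (\<forall>(\<rho>', m, s) \<in> steps_of \<rho>. game_step (last_state \<rho>') m s)"

definition winning_run :: "'m run \<Rightarrow> bool" where
  "winning_run \<rho> \<longleftrightarrow> (\<exists>(q, x, t, y) \<in> states_of \<rho>. q \<in> goal A)"

definition is_strategy :: "'m strategy \<Rightarrow> bool" where
  "is_strategy \<sigma> \<longleftrightarrow> (\<forall>\<rho> \<tau> a. is_run (FinRun \<rho>) \<and> \<sigma> \<rho> = Some (\<tau>, a) \<longrightarrow>
    0 \<le> \<tau> \<and> a \<in> ctrl A \<and> enabled (\<tau>, a) (last_state \<rho>))"

definition consistent :: "'m strategy \<Rightarrow> 'm run \<Rightarrow> bool" where
  "consistent \<sigma> \<rho> \<longleftrightarrow> (\<forall>(\<rho>', (\<tau>', a'), s) \<in> steps_of \<rho>. \<forall>\<tau> a. \<sigma> \<rho>' = Some (\<tau>, a) \<longrightarrow>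
    (\<tau>', a') = (\<tau>, a) \<or> \<tau>' \<le> \<tau> \<and> a' \<in> unctrl A)"

definition maximal_run :: "'m strategy \<Rightarrow> 'm run \<Rightarrow> bool" where
  "maximal_run \<sigma> \<rho> \<longleftrightarrow> (case \<rho> of FinRun \<rho>' \<Rightarrow> \<sigma> \<rho>' = None | InfRun s e \<Rightarrow> True)"

definition winning_from :: "'m strategy \<Rightarrow> nat \<times> 'm list \<Rightarrow> bool" where
  "winning_from \<sigma> = (\<lambda>(q, y). \<forall>x\<in>V1. \<forall>t\<in>V. dyn A q x t = y \<longrightarrow>
    (\<forall>\<rho>. is_run \<rho> \<and> first_state \<rho> = (q, x, t, y) \<and> consistent \<sigma> \<rho> \<and> maximal_run \<sigma> \<rho> \<longrightarrow>
      winning_run \<rho>))"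

definition winning_states :: "(nat \<times> 'm list) set" where
  "winning_states = {s \<in> locs A \<times> V2. \<exists>\<sigma>. is_strategy \<sigma> \<and> winning_from \<sigma> s}"

definition Pred :: "nat \<Rightarrow> (nat \<times> 'm list) set \<Rightarrow> (nat \<times> 'm list) set" where
  "Pred a W = {s \<in> locs A \<times> V2. (\<exists>s'. disc_step A s a s') \<and> (\<forall>s'. disc_step A s a s' \<longrightarrow> s' \<in> W)}"

end

section \<open>Partitions and suffixes\<close>

definition union_of_pieces :: "'s set set \<Rightarrow> 's set \<Rightarrow> bool" where
  "union_of_pieces P W \<longleftrightarrow> (\<exists>S \<subseteq> P. W = \<Union>S)"

definition definable_partition :: "'m::ordered_grp fo_struct \<Rightarrow> nat \<Rightarrow> 'm list set \<Rightarrow> 'm game \<Rightarrow>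
    (nat \<times> 'm list) set set \<Rightarrow> bool" where
  "definable_partition M k2 V2 A P \<longleftrightarrow> partition_on (locs A \<times> V2) P \<and>
    (\<forall>p\<in>P. \<forall>q\<in>locs A. definable M k2 {y. (q, y) \<in> p})"

definition stable_under_Pred :: "'m::ordered_grp list set \<Rightarrow> 'm game \<Rightarrow> (nat \<times> 'm list) set set \<Rightarrow>
    nat \<Rightarrow> bool" where
  "stable_under_Pred V2 A P a \<longleftrightarrow>
    (\<forall>W. union_of_pieces P W \<longrightarrow> union_of_pieces P (Pred V2 A a W))"

text \<open>In general the intervals along a trajectory are infinite in number, in an arbitrary linear
  order type. A word is therefore an isomorphism class of labelled linear orders (carrier, order
  relation, labelling); for finite carriers these are ordinary finite words.\<close>

type_synonym ('i, 'l) labelled_order = "'i set \<times> ('i \<times> 'i) set \<times> ('i \<Rightarrow> 'l)"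

definition labelled_iso :: "('i, 'l) labelled_order \<Rightarrow> ('i, 'l) labelled_order \<Rightarrow> bool" where
  "labelled_iso = (\<lambda>(X, r, l) (X', r', l'). \<exists>f. bij_betw f X X' \<and>
    (\<forall>i\<in>X. \<forall>j\<in>X. (i, j) \<in> r \<longleftrightarrow> (f i, f j) \<in> r') \<and> (\<forall>i\<in>X. l i = l' (f i)))"

definition word_of :: "('i, 'l) labelled_order \<Rightarrow> ('i, 'l) labelled_order set" where
  "word_of w = {w'. labelled_iso w w'}"

definition interval_order :: "('m::linorder set \<times> 'm set) set" where
  "interval_order = {(I, J). \<forall>a\<in>I. \<forall>b\<in>J. a < b}"

context
  fixes V1 :: "'m::ordered_grp list set" and V :: "'m set" and V2 :: "'m list set" and A :: "'m game"
    and P :: "(nat \<times> 'm list) set set"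
begin

text \<open>Intervals are nonempty order-convex subsets, with or without end points in \<open>M\<close>.\<close>

definition homogeneous :: "nat \<Rightarrow> 'm list \<Rightarrow> 'm set \<Rightarrow> bool" where
  "homogeneous q x I \<longleftrightarrow> I \<noteq> {} \<and> I \<subseteq> V \<and> (\<forall>a\<in>I. \<forall>b\<in>I. {a..b} \<subseteq> I) \<and>
    (\<exists>p\<in>P. \<forall>t\<in>I. (q, dyn A q x t) \<in> p)"

definition max_intervals :: "nat \<Rightarrow> 'm list \<Rightarrow> 'm set set" where
  "max_intervals q x = {I. homogeneous q x I \<and> (\<forall>J. homogeneous q x J \<and> I \<subseteq> J \<longrightarrow> J = I)}"

definition suffix_intervals :: "nat \<Rightarrow> 'm list \<Rightarrow> 'm \<Rightarrow> 'm set set" where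
  "suffix_intervals q x t = (\<lambda>I. I \<inter> {t' \<in> V. t \<le> t'}) ` max_intervals q x - {{}}"

definition piece_along :: "nat \<Rightarrow> 'm list \<Rightarrow> 'm set \<Rightarrow> (nat \<times> 'm list) set" where
  "piece_along q x I = (THE p. p \<in> P \<and> (\<forall>t\<in>I. (q, dyn A q x t) \<in> p))"

definition suffix_word :: "nat \<Rightarrow> 'm list \<Rightarrow> 'm \<Rightarrow> ('m set, (nat \<times> 'm list) set) labelled_order set"
  where "suffix_word q x t = word_of (suffix_intervals q x t, interval_order, piece_along q x)"

definition Suf :: "nat \<times> 'm list \<Rightarrow> ('m set, (nat \<times> 'm list) set) labelled_order set set" where
  "Suf = (\<lambda>(q, y). {suffix_word q x t | x t. x \<in> V1 \<and> t \<in> V \<and> dyn A q x t = y})"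

definition Suf_equiv :: "((nat \<times> 'm list) \<times> (nat \<times> 'm list)) set" where
  "Suf_equiv = {(s, s'). s \<in> locs A \<times> V2 \<and> s' \<in> locs A \<times> V2 \<and> fst s = fst s' \<and> Suf s = Suf s'}"

definition Suf_partition :: "(nat \<times> 'm list) set set" where
  "Suf_partition = (locs A \<times> V2) // Suf_equiv"

definition suffix_stable :: bool where
  "suffix_stable \<longleftrightarrow> Suf_partition = P"

end

section \<open>Algorithmic problems on games\<close>

text \<open>The finite descriptions that algorithms receive as inputs: all definable objects are given
  by formulas. A location comes with a formula for its dynamics.\<close>

type_synonym trans_desc = "nat \<times> fm \<times> nat \<times> fm \<times> nat"

record game_desc =
  d_locs :: "(nat \<times> fm) list"
  d_goal :: "nat list"
  d_ctrl :: "nat list"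
  d_unctrl :: "nat list"
  d_trans :: "trans_desc list"

definition describes_trans :: "'m::ordered_grp fo_struct \<Rightarrow> nat \<Rightarrow> 'm list set \<Rightarrow> trans_desc \<Rightarrow>
    'm transition \<Rightarrow> bool" where
  "describes_trans M k2 V2 = (\<lambda>(p, \<phi>, b, \<psi>, p') (q, g, a, R, q').
    p = q \<and> b = a \<and> p' = q' \<and> fm_defines M \<phi> k2 g \<and> fm_defines M \<psi> (k2 + k2) (reset_graph V2 R))"

definition describes :: "'m::ordered_grp fo_struct \<Rightarrow> nat \<Rightarrow> nat \<Rightarrow> 'm list set \<Rightarrow> 'm set \<Rightarrow> 'm list set \<Rightarrow>
    game_desc \<Rightarrow> 'm game \<Rightarrow> bool" where
  "describes M k1 k2 V1 V V2 d A \<longleftrightarrow>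
    fst ` set (d_locs d) = locs A \<and>
    (\<forall>(q, \<phi>) \<in> set (d_locs d). fm_defines M \<phi> (k1 + 1 + k2) (dyn_graph V1 V (dyn A q))) \<and>
    set (d_goal d) = goal A \<and> set (d_ctrl d) = ctrl A \<and> set (d_unctrl d) = unctrl A \<and>
    rel_set (describes_trans M k2 V2) (set (d_trans d)) (transitions A)"

lemma game_has_description:
  assumes "is_game M k1 k2 V1 V V2 A"
  shows "\<exists>d. describes M k1 k2 V1 V V2 d A"
proof -
  have "\<forall>q\<in>locs A. \<exists>\<phi>. fm_defines M \<phi> (k1 + 1 + k2) (dyn_graph V1 V (dyn A q))"
    using assms unfolding is_game_def definable_def by blast
  then obtain f where f: "\<forall>q\<in>locs A. fm_defines M (f q) (k1 + 1 + k2) (dyn_graph V1 V (dyn A q))"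
    by (auto simp: bchoice_iff)
  have "\<exists>td. describes_trans M k2 V2 td tr" if tr: "tr \<in> transitions A" for tr
  proof -
    obtain q g a R q' where tr_eq: "tr = (q, g, a, R, q')" by (cases tr)
    have "definable M k2 g \<and> definable M (k2 + k2) (reset_graph V2 R)"
      using assms tr unfolding is_game_def tr_eq by blast
    then obtain \<phi> \<psi> where "fm_defines M \<phi> k2 g" "fm_defines M \<psi> (k2 + k2) (reset_graph V2 R)"
      unfolding definable_def by blast
    then have "describes_trans M k2 V2 (q, \<phi>, a, \<psi>, q') tr"
      by (simp add: describes_trans_def tr_eq)
    then show ?thesis by blast
  qed
  then obtain h where h: "\<forall>tr\<in>transitions A. describes_trans M k2 V2 (h tr) tr"
    by metis
  have fin: "finite (locs A)" "goal A \<subseteq> locs A" "finite (ctrl A)" "finite (unctrl A)"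
    "finite (transitions A)"
    using assms unfolding is_game_def by blast+
  obtain ls where ls: "set ls = locs A" using finite_list[OF fin(1)] by blast
  obtain gs where gs: "set gs = goal A" using finite_list[OF finite_subset[OF fin(2,1)]] by blast
  obtain cs where cs: "set cs = ctrl A" using finite_list[OF fin(3)] by blast
  obtain us where us: "set us = unctrl A" using finite_list[OF fin(4)] by blast
  obtain ts where ts: "set ts = transitions A" using finite_list[OF fin(5)] by blast
  have "rel_set (describes_trans M k2 V2) (set (map h ts)) (transitions A)"
    using h ts by (auto simp: rel_set_def)
  then have "describes M k1 k2 V1 V V2 \<lparr>d_locs = map (\<lambda>q. (q, f q)) ls, d_goal = gs, d_ctrl = cs,
      d_unctrl = us, d_trans = map h ts\<rparr> A"
    using f ls gs cs us unfolding describes_def by (auto simp: image_image)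
  then show ?thesis by blast
qed

definition loc_fm_list_code :: "(nat \<times> fm) list \<Rightarrow> nat" where
  "loc_fm_list_code ws = list_encode (map (\<lambda>(q, \<phi>). prod_encode (q, fm_code \<phi>)) ws)"

definition trans_desc_code :: "trans_desc \<Rightarrow> nat" where
  "trans_desc_code = (\<lambda>(q, \<phi>, a, \<psi>, q'). list_encode [q, fm_code \<phi>, a, fm_code \<psi>, q'])"

definition game_code :: "game_desc \<Rightarrow> nat" where
  "game_code d = list_encode [loc_fm_list_code (d_locs d), list_encode (d_goal d),
    list_encode (d_ctrl d), list_encode (d_unctrl d), list_encode (map trans_desc_code (d_trans d))]"

text \<open>The inputs are a description of a game of the class, a location, and a formula defining a
  single point of \<open>V\<^sub>2\<close>; nothing is required on other inputs.\<close>

definition control_problem_decidable :: "'m::ordered_grp fo_struct \<Rightarrow> nat \<Rightarrow> nat \<Rightarrow> 'm list set \<Rightarrow>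
    'm set \<Rightarrow> 'm list set \<Rightarrow> 'm game set \<Rightarrow> bool" where
  "control_problem_decidable M k1 k2 V1 V V2 C \<longleftrightarrow>
    (\<exists>f. \<forall>A\<in>C. \<forall>d q y \<phi>.
      describes M k1 k2 V1 V V2 d A \<and> q \<in> locs A \<and> y \<in> V2 \<and> fm_defines M \<phi> k2 {y} \<longrightarrow>
      computes f [game_code d, q, fm_code \<phi>] (if (q, y) \<in> winning_states V1 V V2 A then 1 else 0))"

text \<open>A subset \<open>W\<close> of \<open>Q \<times> V\<^sub>2\<close> is output as a list of formulas, one for each slice of \<open>W\<close> at a
  location.\<close>

definition winning_states_computable :: "'m::ordered_grp fo_struct \<Rightarrow> nat \<Rightarrow> nat \<Rightarrow> 'm list set \<Rightarrow>
    'm set \<Rightarrow> 'm list set \<Rightarrow> 'm game set \<Rightarrow> bool" where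
  "winning_states_computable M k1 k2 V1 V V2 C \<longleftrightarrow>
    (\<exists>f. \<forall>A\<in>C. \<forall>d. describes M k1 k2 V1 V V2 d A \<longrightarrow>
      (\<exists>ws. computes f [game_code d] (loc_fm_list_code ws) \<and> fst ` set ws = locs A \<and>
        (\<forall>(q, \<phi>) \<in> set ws. fm_defines M \<phi> k2 {y. (q, y) \<in> winning_states V1 V V2 A})))"

end

theory Submission
  imports Defs
begin

text \<open>Let \<open>cpre W\<close> consist of the pairs \<open>(q, y)\<close> such that from every trajectory through \<open>y\<close> the
  controller either is in the goal or can pick a later time and a controllable action leading into
  \<open>W\<close> while all uncontrollable actions up to that time lead into \<open>W\<close>. The winning states are the
  least fixed point of \<open>cpre\<close>: positional play by rank wins inside it, and outside any closed set the
  opponent can stay outside forever. Whether a trajectory is good for \<open>W\<close> is visible in its suffix word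
  when \<open>W\<close> is a union of pieces, so a suffix-stable, \<open>Pred\<close>-stable finite partition makes all iterates
  unions of pieces and the iteration stops. Each iterate is given by a formula obtained from the previous
  one by a fixed sequence of constructors, and decidability of the theory lets an unbounded search find
  the first iterate that no longer grows. No bound on the number of pieces needs to be known, and the
  defining formula of \<open>V2\<close> is a constant of the algorithm.\<close>

section \<open>Computable functions on encoded types\<close>

subsection \<open>Pairing and unpairing\<close>

text \<open>The iteration runs on pairs \<open>(q, y)\<close>, not on game states, because a
  discrete step fixes only location and output: which trajectory through that output comes next is
  decided against the controller, just as at the start. This is the quantifier over
  \<open>(x, t)\<close> in \<open>cpre\<close>. A finite run on which the strategy is undefined is
  maximal, so outside the goal the controller can never merely wait; a good time therefore asks for
  an enabled controllable move even where uncontrollable actions alone would lead into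
  \<open>W\<close>.

  Two obstacles shape the transfer along suffix words. A trajectory may pass through infinitely many
  intervals, of any order type and without end points in \<open>M\<close>, so no induction along the
  word is possible; the time of a move is instead replaced by an arbitrary time of the corresponding
  interval. And enabledness needs a successor lying on some trajectory, which \<open>Pred\<close>
  does not demand; stability is therefore also applied to the set of points off all trajectories.

  The partition yields termination of the search and definability of \<open>V2\<close>. That a
  closed iterate equals the winning set holds without it.\<close>

lemma computes_Comp1: "computes g xs y \<Longrightarrow> computes f [y] z \<Longrightarrow> computes (Comp f [g]) xs z"
  by (rule comp[where ys = "[y]"]) auto

lemma computes_Comp2:
  "computes g xs y \<Longrightarrow> computes h xs y' \<Longrightarrow> computes f [y, y'] z \<Longrightarrow> computes (Comp f [g, h]) xs z"
  by (rule comp[where ys = "[y, y']"]) auto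

lemma computes_Comp3:
  "computes g xs y \<Longrightarrow> computes h xs y' \<Longrightarrow> computes k xs y'' \<Longrightarrow> computes f [y, y', y''] z \<Longrightarrow>
    computes (Comp f [g, h, k]) xs z"
  by (rule comp[where ys = "[y, y', y'']"]) auto

lemma computes_Proj: "i < length xs \<Longrightarrow> y = xs ! i \<Longrightarrow> computes (Proj i) xs y"
  using proj by simp

lemma ex_computes_const: "\<exists>r. \<forall>xs. computes r xs c"
proof (induction c)
  case 0
  then show ?case using zero by blast
next
  case (Suc c)
  then show ?case using computes_Comp1 succ by blast
qed

definition "add_recf = PrimRec (Proj 0) (Comp SuccF [Proj 1])"

lemma computes_add: "computes add_recf [m, n] (m + n)"
  unfolding add_recf_def
proof (induction m)
  case 0
  show ?case by (intro prim_0 computes_Proj) auto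
next
  case (Suc m)
  have "computes (Comp SuccF [Proj 1]) [m, m + n, n] (Suc (m + n))"
    by (rule computes_Comp1[OF computes_Proj succ]) auto
  with prim_Suc[OF Suc] show ?case by simp
qed

definition "pred_recf = PrimRec ZeroF (Proj 0)"

lemma computes_pred: "computes pred_recf [n] (n - 1)"
  unfolding pred_recf_def
proof (induction n)
  case 0
  show ?case using prim_0[OF zero] by simp
next
  case (Suc n)
  show ?case by (rule prim_Suc[OF Suc]) (auto intro: computes_Proj)
qed

text \<open>The arguments are swapped because recursion is on the first one.\<close>

definition "sub_recf = PrimRec (Proj 0) (Comp pred_recf [Proj 1])"

lemma computes_sub: "computes sub_recf [m, n] (n - m)"
  unfolding sub_recf_def
proof (induction m)
  case 0
  show ?case by (intro prim_0 computes_Proj) auto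
next
  case (Suc m)
  have "computes (Comp pred_recf [Proj 1]) [m, n - m, n] (n - m - 1)"
    by (rule computes_Comp1[OF computes_Proj computes_pred]) auto
  with prim_Suc[OF Suc] show ?case by simp
qed

definition "triangle_recf = PrimRec ZeroF (Comp add_recf [Proj 1, Comp SuccF [Proj 0]])"

lemma computes_triangle: "computes triangle_recf [n] (triangle n)"
  unfolding triangle_recf_def
proof (induction n)
  case 0
  show ?case using prim_0[OF zero] by simp
next
  case (Suc n)
  have "computes (Comp add_recf [Proj 1, Comp SuccF [Proj 0]]) [n, triangle n] (triangle n + Suc n)"
    by (rule computes_Comp2[OF computes_Proj computes_Comp1[OF computes_Proj succ] computes_add]) auto
  with prim_Suc[OF Suc] show ?case by simp
qed

definition "pair_recf = Comp add_recf [Comp triangle_recf [add_recf], Proj 0]"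

lemma computes_pair: "computes pair_recf [m, n] (prod_encode (m, n))"
  unfolding pair_recf_def prod_encode_def prod.case
  by (rule computes_Comp2[OF computes_Comp1[OF computes_add computes_triangle] computes_Proj computes_add]) auto

text \<open>Since \<open>prod_encode (m, n)\<close> is \<open>triangle (m + n) + m\<close>, the
  diagonal \<open>m + n\<close> is the least \<open>s\<close> for which the code is below
  \<open>triangle (Suc s)\<close>. The successor on the code turns this strict inequality into a
  zero of truncated subtraction. Subtracting the triangular number of the diagonal from the code
  then leaves \<open>m\<close>.\<close>

definition "diagonal_recf = Mu (Comp sub_recf [Comp triangle_recf [Comp SuccF [Proj 0]], Comp SuccF [Proj 1]])"

lemma triangle_mono: "m \<le> n \<Longrightarrow> triangle m \<le> triangle n"
  by (induction n) (auto simp: le_Suc_eq)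

lemma computes_diagonal: "computes diagonal_recf [prod_encode (m, n)] (m + n)"
proof -
  let ?p = "prod_encode (m, n)"
  have *: "computes (Comp sub_recf [Comp triangle_recf [Comp SuccF [Proj 0]], Comp SuccF [Proj 1]])
      [s, ?p] (Suc ?p - triangle (Suc s))" for s
    by (rule computes_Comp2[OF computes_Comp1[OF computes_Comp1[OF computes_Proj succ] computes_triangle]
          computes_Comp1[OF computes_Proj succ] computes_sub]) auto
  have "Suc ?p - triangle (Suc (m + n)) = 0"
    by (simp add: prod_encode_def)
  moreover have "\<exists>k. Suc ?p - triangle (Suc s) = Suc k" if "s < m + n" for s
  proof -
    have "triangle (Suc s) \<le> triangle (m + n)" using that by (intro triangle_mono) simp
    then show ?thesis by (intro exI[of _ "?p - triangle (Suc s)"]) (simp add: prod_encode_def)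
  qed
  ultimately show ?thesis
    unfolding diagonal_recf_def by (intro mu) (metis *)+
qed

definition "fst_recf = Comp sub_recf [Comp triangle_recf [diagonal_recf], Proj 0]"

lemma computes_fst: "computes fst_recf [prod_encode (m, n)] m"
proof -
  have "computes fst_recf [prod_encode (m, n)] (prod_encode (m, n) - triangle (m + n))"
    unfolding fst_recf_def
    by (rule computes_Comp2[OF computes_Comp1[OF computes_diagonal computes_triangle] computes_Proj computes_sub]) auto
  then show ?thesis by (simp add: prod_encode_def)
qed

definition "snd_recf = Comp sub_recf [fst_recf, diagonal_recf]"

lemma computes_snd: "computes snd_recf [prod_encode (m, n)] n"
  using computes_Comp2[OF computes_fst[of m n] computes_diagonal computes_sub]
  unfolding snd_recf_def by simp

text \<open>A case distinction as a recursion of depth at most one. The step sees counter and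
  previous value in front of the two branches, so its \<open>Proj 2\<close> is the first branch,
  while \<open>Proj 1\<close> in the base is the second.\<close>

definition "if_recf = PrimRec (Proj 1) (Proj 2)"

lemma computes_if: "computes if_recf [of_bool b, m, n] (if b then m else n)"
proof -
  have 0: "computes (PrimRec (Proj 1) (Proj 2)) [0, m, n] n"
    by (intro prim_0 computes_Proj) auto
  have "computes (PrimRec (Proj 1) (Proj 2)) [Suc 0, m, n] m"
    by (rule prim_Suc[OF 0]) (auto intro: computes_Proj)
  with 0 show ?thesis by (simp add: if_recf_def)
qed

subsection \<open>Encoded types\<close>

class encodable =
  fixes enc :: "'a \<Rightarrow> nat"

instantiation nat :: encodable
begin
definition enc_nat :: "nat \<Rightarrow> nat" where "enc_nat n = n"
instance ..
end

instantiation bool :: encodable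
begin
definition enc_bool :: "bool \<Rightarrow> nat" where "enc_bool b = of_bool b"
instance ..
end

instantiation prod :: (encodable, encodable) encodable
begin
definition enc_prod :: "'a \<times> 'b \<Rightarrow> nat" where "enc_prod p = prod_encode (enc (fst p), enc (snd p))"
instance ..
end

instantiation list :: (encodable) encodable
begin
definition enc_list :: "'a list \<Rightarrow> nat" where "enc_list xs = list_encode (map enc xs)"
instance ..
end

instantiation fm :: encodable
begin
definition enc_fm :: "fm \<Rightarrow> nat" where "enc_fm = fm_code"
instance ..
end

lemmas enc_defs = enc_nat_def enc_bool_def enc_prod_def enc_list_def enc_fm_def

text \<open>Unary, so that several arguments travel as pairs. The closure rules below keep a common
  argument \<open>x\<close> in every part, which lets them follow the syntax of a
  definition.\<close>

definition computable :: "('a::encodable \<Rightarrow> 'b::encodable) \<Rightarrow> bool" where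
  "computable f \<longleftrightarrow> (\<exists>r. \<forall>x. computes r [enc x] (enc (f x)))"

named_theorems computable_intros

lemma computable_ident [computable_intros]: "computable (\<lambda>x. x)"
  unfolding computable_def by (intro exI[of _ "Proj 0"]) (auto intro: computes_Proj)

lemma computable_const [computable_intros]: "computable (\<lambda>x. c)"
  unfolding computable_def using ex_computes_const by blast

lemma computable_compose: "computable f \<Longrightarrow> computable g \<Longrightarrow> computable (\<lambda>x. g (f x))"
  unfolding computable_def using computes_Comp1 by meson

lemma computable_Pair [computable_intros]:
  assumes "computable f" and "computable g"
  shows "computable (\<lambda>x. (f x, g x))"
proof -
  obtain r s where "computes r [enc x] (enc (f x))" "computes s [enc x] (enc (g x))" for x
    using assms unfolding computable_def by auto
  then show ?thesis
    unfolding computable_def enc_prod_def fst_conv snd_conv by (meson computes_Comp2 computes_pair)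
qed

lemma computable_fst [computable_intros]:
  "computable f \<Longrightarrow> computable (\<lambda>x. fst (f x))"
  by (rule computable_compose) (auto simp: computable_def enc_prod_def intro: computes_fst)

lemma computable_snd [computable_intros]:
  "computable f \<Longrightarrow> computable (\<lambda>x. snd (f x))"
  by (rule computable_compose) (auto simp: computable_def enc_prod_def intro: computes_snd)

text \<open>Meant for destructors: \<open>h\<close> works on numbers and may behave arbitrarily on
  those that are not codes.\<close>

lemma computable_via_codes:
  fixes f :: "'a::encodable \<Rightarrow> 'b::encodable" and h :: "nat \<Rightarrow> nat"
  assumes "computable h" and "\<And>x. h (enc x) = enc (f x)"
  shows "computable f"
proof -
  obtain r where "computes r [enc n] (enc (h n))" for n
    using assms(1) unfolding computable_def by auto
  then have "computes r [enc x] (enc (f x))" for x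
    using assms(2) by (metis enc_nat_def)
  then show ?thesis unfolding computable_def by blast
qed

lemma computable_enc: "computable (enc :: 'a::encodable \<Rightarrow> nat)"
  unfolding computable_def by (intro exI[of _ "Proj 0"]) (auto intro: computes_Proj simp: enc_nat_def)

text \<open>Meant for constructors: numbers are their own codes, so computing the code of a value
  amounts to computing the value.\<close>

lemma computable_from_enc:
  fixes f :: "'a::encodable \<Rightarrow> 'b::encodable"
  assumes "computable (\<lambda>x. enc (f x))"
  shows "computable f"
  using assms by (simp add: computable_def enc_nat_def)

lemma computable_If [computable_intros]:
  assumes "computable b" and "computable f" and "computable g"
  shows "computable (\<lambda>x. if b x then f x else g x)"
proof -
  obtain r s t where "computes r [enc x] (of_bool (b x))" "computes s [enc x] (enc (f x))"
      "computes t [enc x] (enc (g x))" for x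
    using assms unfolding computable_def enc_bool_def by auto
  then have "computes (Comp if_recf [r, s, t]) [enc x] (if b x then enc (f x) else enc (g x))" for x
    by (meson computes_Comp3 computes_if)
  then have "computes (Comp if_recf [r, s, t]) [enc x] (enc (if b x then f x else g x))" for x
    by (simp add: if_distrib)
  then show ?thesis unfolding computable_def by blast
qed

lemma computable_conj [computable_intros]:
  assumes "computable b" and "computable c"
  shows "computable (\<lambda>x. b x \<and> c x)"
proof -
  have "(\<lambda>x. b x \<and> c x) = (\<lambda>x. if b x then c x else False)" by auto
  then show ?thesis using assms by (simp only:) (intro computable_intros)
qed

lemma computable_Suc [computable_intros]: "computable f \<Longrightarrow> computable (\<lambda>x. Suc (f x))"
  by (rule computable_compose) (auto simp: computable_def enc_nat_def intro: succ)

lemma computable_diff [computable_intros]: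
  fixes f g :: "'a::encodable \<Rightarrow> nat"
  assumes "computable f" and "computable g"
  shows "computable (\<lambda>x. f x - g x)"
proof -
  obtain r s where "computes r [enc x] (f x)" "computes s [enc x] (g x)" for x
    using assms unfolding computable_def enc_nat_def by auto
  then show ?thesis
    unfolding computable_def enc_nat_def by (meson computes_Comp2 computes_sub)
qed

lemma computable_is_0 [computable_intros]:
  assumes "computable f"
  shows "computable (\<lambda>x. f x = (0::nat))"
proof (rule computable_from_enc)
  have "(\<lambda>x. enc (f x = 0)) = (\<lambda>x. 1 - f x)" by (auto simp: enc_bool_def)
  then show "computable (\<lambda>x. enc (f x = 0))"
    using assms by (simp only:) (intro computable_intros)
qed

lemma computable_eq_nat [computable_intros]:
  fixes f g :: "'a::encodable \<Rightarrow> nat"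
  assumes "computable f" and "computable g"
  shows "computable (\<lambda>x. f x = g x)"
proof -
  have "(\<lambda>x. f x = g x) = (\<lambda>x. f x - g x = 0 \<and> g x - f x = 0)" by auto
  then show ?thesis using assms by (simp only:) (intro computable_intros)
qed

lemma computable_funpow:
  fixes step :: "'a::encodable \<Rightarrow> 'b::encodable \<Rightarrow> 'b"
  assumes "computable (\<lambda>p. step (fst p) (snd p))" and "computable k" and "computable start"
  shows "computable (\<lambda>x. (step x ^^ k x) (start x))"
proof -
  obtain r s t where r: "\<And>x y. computes r [prod_encode (enc x, enc y)] (enc (step x y))"
    and s: "\<And>x. computes s [enc x] (k x)" and t: "\<And>x. computes t [enc x] (enc (start x))"
    using assms unfolding computable_def enc_nat_def enc_prod_def
    by (metis fst_conv snd_conv)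
  \<comment> \<open>The arguments of the step are counter, current iterate, start and parameter;
    hence \<open>Proj 3\<close> for \<open>x\<close> and \<open>Proj 1\<close> for the
    iterate.\<close>
  let ?it = "PrimRec (Proj 0) (Comp r [Comp pair_recf [Proj 3, Proj 1]])"
  have "computes ?it [n, enc y, enc x] (enc ((step x ^^ n) y))" for n x y
  proof (induction n)
    case 0
    show ?case by (intro prim_0) (auto intro: computes_Proj)
  next
    case (Suc n)
    have "computes (Comp r [Comp pair_recf [Proj 3, Proj 1]])
        [n, enc ((step x ^^ n) y), enc y, enc x] (enc ((step x ^^ Suc n) y))"
      unfolding funpow.simps o_apply
      by (rule computes_Comp1[OF computes_Comp2[OF computes_Proj computes_Proj computes_pair] r]) auto
    with Suc show ?case by (rule prim_Suc)
  qed
  then have "computes (Comp ?it [s, t, Proj 0]) [enc x] (enc ((step x ^^ k x) (start x)))" for x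
    using computes_Comp3[OF s t computes_Proj] by simp
  then show ?thesis unfolding computable_def by blast
qed

lemma computable_prod_encode [computable_intros]:
  "computable f \<Longrightarrow> computable g \<Longrightarrow> computable (\<lambda>x. prod_encode (f x, g x))"
  using computable_Pair[of f g] by (simp add: computable_def enc_prod_def enc_nat_def)

lemma computable_prod_decode:
  assumes "computable f"
  shows "computable (\<lambda>x. prod_decode (f x))"
  using assms by (simp add: computable_def enc_prod_def enc_nat_def)

subsection \<open>Lists\<close>

lemma computable_Nil_eq [computable_intros]:
  assumes "computable f"
  shows "computable (\<lambda>x. f x = [])"
proof -
  have "(\<lambda>xs::'b list. xs = []) = (\<lambda>xs. enc xs = 0)"
  proof
    show "(xs = []) = (enc xs = 0)" for xs :: "'b list" by (cases xs) (auto simp: enc_list_def)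
  qed
  then have "computable (\<lambda>xs::'b list. xs = [])"
    by (simp only:) (intro computable_intros computable_enc)
  then show ?thesis by (rule computable_compose[OF assms])
qed

lemma computable_Cons [computable_intros]:
  assumes "computable f" and "computable g"
  shows "computable (\<lambda>x. f x # g x)"
proof (rule computable_from_enc)
  have "(\<lambda>x. enc (f x # g x)) = (\<lambda>x. Suc (prod_encode (enc (f x), enc (g x))))"
    by (auto simp: enc_list_def)
  then show "computable (\<lambda>x. enc (f x # g x))"
    using assms by (simp only:) (intro computable_intros computable_compose[OF _ computable_enc])
qed

text \<open>Makes the empty list come out right under \<open>tl\<close>: its code \<open>0\<close>
  has predecessor \<open>0\<close>, whose second component is again the code of the empty
  list.\<close>

lemma prod_decode_0: "prod_decode 0 = (0, 0)"
  using prod_encode_inverse[of "(0, 0)"] by (simp add: prod_encode_def)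

lemma computable_tl [computable_intros]:
  assumes "computable f"
  shows "computable (\<lambda>x. tl (f x))"
proof (rule computable_compose[OF assms])
  show "computable (tl :: 'b list \<Rightarrow> 'b list)"
  proof (rule computable_via_codes)
    show "computable (\<lambda>n. snd (prod_decode (n - 1)))"
      by (intro computable_intros computable_prod_decode)
    show "snd (prod_decode (enc xs - 1)) = enc (tl xs)" for xs :: "'b list"
      by (cases xs) (auto simp: enc_list_def prod_decode_0)
  qed
qed

lemma computable_hd [computable_intros]:
  assumes "computable f"
  shows "computable (\<lambda>x. hd (f x))"
proof (rule computable_compose[OF assms])
  show "computable (hd :: 'b list \<Rightarrow> 'b)"
  proof (rule computable_via_codes)
    \<comment> \<open>The value \<open>hd []\<close> is unspecified but fixed, so its code can be a
      constant of the machine.\<close>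
    show "computable (\<lambda>n. if n = 0 then enc (hd [] :: 'b) else fst (prod_decode (n - 1)))"
      by (intro computable_intros computable_prod_decode)
    show "(if enc xs = 0 then enc (hd [] :: 'b) else fst (prod_decode (enc xs - 1))) = enc (hd xs)"
      for xs :: "'b list"
      by (cases xs) (auto simp: enc_list_def)
  qed
qed

lemma length_le_enc: "length xs \<le> enc xs"
proof (induction xs)
  case (Cons x xs)
  then show ?case
    using le_prod_encode_2[of "enc xs" "enc x"] by (simp add: enc_list_def)
qed simp

text \<open>The step idles on an empty list, so any upper bound of the length can serve as the
  number of iterations.\<close>

lemma funpow_fold_step:
  assumes "length xs \<le> n"
  shows "((\<lambda>s. if fst s = [] then s else (tl (fst s), g (hd (fst s)) (snd s))) ^^ n) (xs, a) =
    ([], fold g xs a)"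
  using assms
proof (induction n arbitrary: xs a)
  case (Suc n)
  then show ?case by (cases xs) (auto simp: funpow_Suc_right simp del: funpow.simps)
qed auto

text \<open>The code of a list bounds its length, hence the number of iterations needed.\<close>

lemma computable_fold [computable_intros]:
  fixes g :: "'a::encodable \<Rightarrow> 'b::encodable \<Rightarrow> 'c::encodable \<Rightarrow> 'c"
  assumes "computable (\<lambda>p. g (fst p) (fst (snd p)) (snd (snd p)))"
    and "computable l" and "computable a"
  shows "computable (\<lambda>x. fold (g x) (l x) (a x))"
proof -
  let ?step = "\<lambda>x s. if fst s = [] then s else (tl (fst s), g x (hd (fst s)) (snd s))"
  have "computable (\<lambda>p. g (fst p) (hd (fst (snd p))) (snd (snd p)))"
    using computable_compose[OF _ assms(1), of "\<lambda>p. (fst p, hd (fst (snd p)), snd (snd p))"]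
    by (simp add: computable_intros)
  then have "computable (\<lambda>p. ?step (fst p) (snd p))"
    by (intro computable_intros) auto
  then have "computable (\<lambda>x. snd ((?step x ^^ enc (l x)) (l x, a x)))"
    by (intro computable_snd computable_funpow computable_Pair computable_compose[OF _ computable_enc] assms)
  then show ?thesis by (simp add: funpow_fold_step length_le_enc)
qed

lemma computable_rev [computable_intros]:
  assumes "computable l"
  shows "computable (\<lambda>x. rev (l x))"
proof -
  have "rev xs = fold Cons xs []" for xs :: "'b list"
    by (simp add: fold_Cons_rev)
  then show ?thesis
    by (simp only:) (intro computable_intros assms)
qed

lemma computable_map [computable_intros]:
  fixes g :: "'a::encodable \<Rightarrow> 'b::encodable \<Rightarrow> 'c::encodable"
  assumes "computable (\<lambda>p. g (fst p) (snd p))" and "computable l"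
  shows "computable (\<lambda>x. map (g x) (l x))"
proof -
  have "map f xs = fold (\<lambda>y ys. f y # ys) (rev xs) []" for f :: "'b \<Rightarrow> 'c" and xs
    by (induction xs) auto
  moreover have "computable (\<lambda>p. g (fst p) (fst (snd p)))"
    using computable_compose[OF _ assms(1), of "\<lambda>p. (fst p, fst (snd p))"]
    by (simp add: computable_intros)
  ultimately show ?thesis
    by (simp only:) (intro computable_intros assms)
qed

lemma fold_or: "fold (\<lambda>y b. if P y then True else b) ys b \<longleftrightarrow> b \<or> (\<exists>y\<in>set ys. P y)"
  by (induction ys arbitrary: b) auto

lemma computable_mem [computable_intros]:
  fixes f :: "'a::encodable \<Rightarrow> nat"
  assumes "computable f" and "computable l"
  shows "computable (\<lambda>x. f x \<in> set (l x))"
proof -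
  have "(f x \<in> set (l x)) = fold (\<lambda>y b. if f x = y then True else b) (l x) False" for x
    by (auto simp: fold_or)
  then show ?thesis
    by (simp only:) (intro computable_intros assms computable_compose[OF _ assms(1)])
qed

subsection \<open>Formulas\<close>

lemma computable_Neg [computable_intros]:
  assumes "computable f"
  shows "computable (\<lambda>x. Neg (f x))"
proof (rule computable_from_enc)
  have "(\<lambda>x. enc (Neg (f x))) = (\<lambda>x. prod_encode (3, enc (f x)))"
    by (auto simp: enc_fm_def)
  then show "computable (\<lambda>x. enc (Neg (f x)))"
    using assms by (simp only:) (intro computable_intros computable_compose[OF _ computable_enc])
qed

lemma computable_Conj [computable_intros]:
  assumes "computable f" and "computable g"
  shows "computable (\<lambda>x. Conj (f x) (g x))"
proof (rule computable_from_enc)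
  have "(\<lambda>x. enc (Conj (f x) (g x))) = (\<lambda>x. prod_encode (4, prod_encode (enc (f x), enc (g x))))"
    by (auto simp: enc_fm_def)
  then show "computable (\<lambda>x. enc (Conj (f x) (g x)))"
    using assms by (simp only:) (intro computable_intros computable_compose[OF _ computable_enc])
qed

lemma computable_Ex [computable_intros]:
  assumes "computable f"
  shows "computable (\<lambda>x. Ex i (f x))"
proof (rule computable_from_enc)
  have "(\<lambda>x. enc (Ex i (f x))) = (\<lambda>x. prod_encode (5, prod_encode (i, enc (f x))))"
    by (auto simp: enc_fm_def)
  then show "computable (\<lambda>x. enc (Ex i (f x)))"
    using assms by (simp only:) (intro computable_intros computable_compose[OF _ computable_enc])
qed

lemma computable_Th:
  assumes "decidable_theory M" and "computable f"
  shows "computable (\<lambda>x. f x \<in> Th M)"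
proof (rule computable_compose[OF assms(2)])
  obtain r where r: "computes r [n] (if n \<in> fm_code ` Th M then 1 else 0)" for n
    using assms(1) unfolding decidable_theory_def decidable_set_def by blast
  have "fm_code \<phi> \<in> fm_code ` Th M \<longleftrightarrow> \<phi> \<in> Th M" for \<phi>
    by (auto simp: fm_code_inject)
  then have "computes r [enc \<phi>] (enc (\<phi> \<in> Th M))" for \<phi>
    using r[of "fm_code \<phi>"] by (simp add: enc_fm_def enc_bool_def split: if_splits)
  then show "computable (\<lambda>\<phi>. \<phi> \<in> Th M)" unfolding computable_def by blast
qed

text \<open>The one place where partiality enters: \<open>computable\<close> demands a value
  everywhere, so the result of an unbounded search is stated for those arguments only for which it
  ends. The test is total, so no smaller candidate blocks the search, and it returns
  \<open>0\<close> for success because \<open>Mu\<close> looks for a zero.\<close>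

lemma computes_at_Least:
  fixes h :: "'a::encodable \<Rightarrow> nat \<Rightarrow> 'b::encodable"
  assumes "computable (\<lambda>p. Q (fst p) (snd p))" and "computable (\<lambda>p. h (fst p) (snd p))"
  shows "\<exists>r. \<forall>x. (\<exists>n. Q x n) \<longrightarrow> computes r [enc x] (enc (h x (LEAST n. Q x n)))"
proof -
  have "computable (\<lambda>p. if Q (fst p) (snd p) then 0 else 1 :: nat)"
    by (intro computable_intros assms)
  then obtain r where r: "computes r [prod_encode (enc x, n)] (if Q x n then 0 else 1)" for x n
    unfolding computable_def enc_prod_def enc_nat_def by fastforce
  obtain s where s: "computes s [prod_encode (enc x, n)] (enc (h x n))" for x n
    using assms(2) unfolding computable_def enc_prod_def enc_nat_def by fastforce
  let ?r = "Comp r [Comp pair_recf [Proj 1, Proj 0]]"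
  have r': "computes ?r [n, enc x] (if Q x n then 0 else 1)" for x n
    by (rule computes_Comp1[OF computes_Comp2[OF computes_Proj computes_Proj computes_pair] r]) auto
  have "computes (Comp s [Comp pair_recf [Proj 0, Mu ?r]]) [enc x] (enc (h x (LEAST n. Q x n)))"
    if "\<exists>n. Q x n" for x
  proof -
    have "computes (Mu ?r) [enc x] (LEAST n. Q x n)"
    proof (rule mu)
      show "computes ?r [LEAST n. Q x n, enc x] 0"
        using r'[of "LEAST n. Q x n" x] LeastI_ex[OF that] by simp
      show "\<forall>m<LEAST n. Q x n. \<exists>k. computes ?r [m, enc x] (Suc k)"
      proof (intro allI impI exI)
        show "computes ?r [m, enc x] (Suc 0)" if "m < (LEAST n. Q x n)" for m
          using r'[of m x] not_less_Least[OF that] by simp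
      qed
    qed
    then show ?thesis
      by (intro computes_Comp1[OF computes_Comp2[OF computes_Proj _ computes_pair] s]) auto
  qed
  then show ?thesis by blast
qed

section \<open>The attractor of the goal\<close>

text \<open>The group need not be commutative. Delays are added on the right of the time, so
  cancellation on the left is the one needed, and the delay from \<open>t\<close> to
  \<open>t'\<close> is \<open>- t + t'\<close>.\<close>

lemma grp_add_le_cancel_left: "c + a \<le> c + b \<longleftrightarrow> a \<le> (b::'m::ordered_grp)"
  using grp_add_left_mono[of "c + a" "c + b" "- c"] grp_add_left_mono[of a b c]
  by auto

lemma grp_le_add_same: "a \<le> a + b \<longleftrightarrow> 0 \<le> (b::'m::ordered_grp)"
  using grp_add_le_cancel_left[of a 0 b] by simp

lemma steps_of_snoc:
  "steps_of (FinRun (s, es @ [e])) = insert ((s, es), e) (steps_of (FinRun (s, es)))"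
proof -
  have img: "steps_of (FinRun (s, es)) = (\<lambda>i. ((s, take i es), es ! i)) ` {..<length es}" for es
    by auto
  show ?thesis unfolding img by (auto simp: lessThan_Suc nth_append intro!: image_cong)
qed

lemma steps_of_Nil: "steps_of (FinRun (s, [])) = {}"
  by simp

text \<open>Reduces legality and consistency of an infinite run to its finite prefixes.\<close>

lemma steps_of_InfRun: "steps_of (InfRun s e) = (\<Union>n. steps_of (FinRun (s, map e [0..<n])))"
proof -
  have "steps_of (FinRun (s, map e [0..<n])) = {((s, map e [0..<i]), e i) | i. i < n}" for n
  proof (induction n)
    case (Suc n)
    show ?case unfolding upt_Suc_append[OF le0] map_append list.map steps_of_snoc Suc
      by (auto simp: less_Suc_eq)
  qed simp
  then show ?thesis by auto
qed

declare steps_of.simps [simp del]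

section \<open>Controllable predecessors and their iterates\<close>

locale game_arena =
  fixes V1 :: "'m::ordered_grp list set" and V :: "'m set" and V2 :: "'m list set" and A :: "'m game"
  assumes disc_step_closed: "disc_step A s a s' \<Longrightarrow> s \<in> locs A \<times> V2 \<and> s' \<in> locs A \<times> V2"
    and dyn_closed: "q \<in> locs A \<Longrightarrow> x \<in> V1 \<Longrightarrow> t \<in> V \<Longrightarrow> dyn A q x t \<in> V2"
begin

text \<open>A point of \<open>V2\<close> off all trajectories of its location has no game state above it: it cannot
  be entered and is vacuously winning.\<close>

definition alive :: "nat \<times> 'm list \<Rightarrow> bool" where
  "alive s \<longleftrightarrow> (\<exists>x\<in>V1. \<exists>t\<in>V. dyn A (fst s) x t = snd s)"

text \<open>The existential part expresses that the action is enabled, which needs a successor with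
  a game state above it. Dead successors require no exception in the universal parts here and in
  \<open>safe\<close>: they lie in \<open>cpre W\<close> for every \<open>W\<close>, hence in every
  iterate after \<open>attr 0\<close>.\<close>

definition forces :: "(nat \<times> 'm list) set \<Rightarrow> nat \<Rightarrow> nat \<times> 'm list \<Rightarrow> bool" where
  "forces W a s \<longleftrightarrow> (\<exists>s'. disc_step A s a s' \<and> alive s') \<and> (\<forall>s'. disc_step A s a s' \<longrightarrow> s' \<in> W)"

definition safe :: "(nat \<times> 'm list) set \<Rightarrow> nat \<times> 'm list \<Rightarrow> bool" where
  "safe W s \<longleftrightarrow> (\<forall>u\<in>unctrl A. \<forall>s'. disc_step A s u s' \<longrightarrow> s' \<in> W)"

text \<open>Safety includes the time \<open>t'\<close> itself, because an uncontrollable action may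
  also come with exactly the delay chosen by the controller.\<close>

definition good_time :: "(nat \<times> 'm list) set \<Rightarrow> nat \<Rightarrow> 'm list \<Rightarrow> 'm \<Rightarrow> 'm \<Rightarrow> bool" where
  "good_time W q x t t' \<longleftrightarrow> t' \<in> V \<and> t \<le> t' \<and> (\<exists>a\<in>ctrl A. forces W a (q, dyn A q x t')) \<and>
    (\<forall>t''\<in>V. t \<le> t'' \<and> t'' \<le> t' \<longrightarrow> safe W (q, dyn A q x t''))"

definition cpre :: "(nat \<times> 'm list) set \<Rightarrow> (nat \<times> 'm list) set" where
  "cpre W = {s \<in> locs A \<times> V2. \<forall>x\<in>V1. \<forall>t\<in>V. dyn A (fst s) x t = snd s \<longrightarrow>
    fst s \<in> goal A \<or> (\<exists>t'. good_time W (fst s) x t t')}"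

lemma cpre_mono:
  assumes "W \<subseteq> W'"
  shows "cpre W \<subseteq> cpre W'"
proof -
  have "forces W a s \<Longrightarrow> forces W' a s" and "safe W s \<Longrightarrow> safe W' s" for a s
    using assms unfolding forces_def safe_def by blast+
  then have "good_time W q x t t' \<Longrightarrow> good_time W' q x t t'" for q x t t'
    unfolding good_time_def by blast
  then show ?thesis unfolding cpre_def by blast
qed

definition attr :: "nat \<Rightarrow> (nat \<times> 'm list) set" where
  "attr n = (cpre ^^ n) {}"

lemma attr_0 [simp]: "attr 0 = {}"
  and attr_Suc [simp]: "attr (Suc n) = cpre (attr n)"
  by (simp_all add: attr_def)

lemma attr_Suc_mono: "attr n \<subseteq> attr (Suc n)"
  by (induction n) (simp_all add: cpre_mono)

lemma attr_subset: "attr n \<subseteq> locs A \<times> V2"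
  by (cases n) (auto simp: cpre_def)

subsection \<open>The attractor is winning\<close>

definition rank :: "nat \<times> 'm list \<Rightarrow> nat" where
  "rank s = (LEAST n. s \<in> attr n)"

lemma rank_le: "s \<in> attr n \<Longrightarrow> rank s \<le> n"
  unfolding rank_def by (rule Least_le)

lemma in_cpre_rank:
  assumes "s \<in> attr n"
  shows "0 < rank s" and "s \<in> cpre (attr (rank s - 1))"
proof -
  have *: "s \<in> attr (rank s)" unfolding rank_def using assms by (rule LeastI)
  then show "0 < rank s" by (cases "rank s") auto
  then show "s \<in> cpre (attr (rank s - 1))" using * by (cases "rank s") auto
qed

definition good_move :: "(nat \<times> 'm list) set \<Rightarrow> 'm state \<Rightarrow> 'm move \<Rightarrow> bool" where
  "good_move W = (\<lambda>(q, x, t, y) (\<tau>, a). a \<in> ctrl A \<and> good_time W q x t (t + \<tau>) \<and>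
    forces W a (q, dyn A q x (t + \<tau>)))"

fun point :: "'m state \<Rightarrow> nat \<times> 'm list" where
  "point (q, x, t, y) = (q, y)"

lemma good_move_ex:
  assumes "is_state V1 V A s" and "point s \<in> cpre W" and "fst s \<notin> goal A"
  shows "\<exists>m. good_move W s m"
proof -
  obtain q x t y where s: "s = (q, x, t, y)" by (cases s)
  then obtain t' a where t': "good_time W q x t t'" and a: "a \<in> ctrl A" "forces W a (q, dyn A q x t')"
    using assms unfolding is_state_def cpre_def by simp (metis good_time_def)
  have "good_move W s (- t + t', a)" using t' a by (simp add: s good_move_def add.assoc[symmetric])
  then show ?thesis by blast
qed

lemma good_move_enabled:
  assumes "is_state V1 V A s" and "good_move W s (\<tau>, a)"
  shows "0 \<le> \<tau> \<and> a \<in> ctrl A \<and> enabled V1 V A (\<tau>, a) s"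
proof -
  obtain q x t y where s: "s = (q, x, t, y)" by (cases s)
  obtain q' y' where step: "disc_step A (q, dyn A q x (t + \<tau>)) a (q', y')" and "alive (q', y')"
    using assms(2) unfolding s good_move_def forces_def by auto
  \<comment> \<open>The alive successor supplies the trajectory that turns a discrete step into a
    game step.\<close>
  then obtain x' t' where "x' \<in> V1" "t' \<in> V" "dyn A q' x' t' = y'"
    unfolding alive_def by auto
  then have "game_step V1 V A s (\<tau>, a) (q', x', t', y')"
    using assms step disc_step_closed[OF step]
    unfolding s game_step_def time_step_def is_state_def good_move_def good_time_def
    by (auto simp: grp_le_add_same)
  then show ?thesis
    using assms unfolding s good_move_def good_time_def enabled_def by (auto simp: grp_le_add_same)
qed

lemma good_move_step:
  assumes "good_move W s (\<tau>, a)" and "game_step V1 V A s (\<tau>', a') s'"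
    and "(\<tau>', a') = (\<tau>, a) \<or> \<tau>' \<le> \<tau> \<and> a' \<in> unctrl A"
  shows "point s' \<in> W"
proof -
  obtain q x t y where s: "s = (q, x, t, y)" by (cases s)
  obtain q' x' t' y' where s': "s' = (q', x', t', y')" by (cases s')
  have step: "disc_step A (q, dyn A q x (t + \<tau>')) a' (q', y')" "0 \<le> \<tau>'" "t + \<tau>' \<in> V"
    using assms(2) unfolding s s' game_step_def time_step_def is_state_def by auto
  from assms(3) show ?thesis
  proof
    assume "(\<tau>', a') = (\<tau>, a)"
    then show ?thesis using assms(1) step(1) unfolding s s' good_move_def forces_def by auto
  next
    assume "\<tau>' \<le> \<tau> \<and> a' \<in> unctrl A"
    then show ?thesis
      using assms(1) step unfolding s s' good_move_def good_time_def safe_def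
      by (auto simp: grp_le_add_same grp_add_le_cancel_left)
  qed
qed

text \<open>Undefined at the goal, where the run is already won, and off all iterates, where nothing
  is claimed. Aiming at the iterate below the rank, rather than at the iterate itself, forces
  progress.\<close>

definition attr_strategy :: "'m strategy" where
  "attr_strategy \<rho> = (let s = last_state \<rho> in
    if fst s \<in> goal A \<or> (\<forall>n. point s \<notin> attr n) then None
    else Some (SOME m. good_move (attr (rank (point s) - 1)) s m))"

lemma game_step_is_state: "game_step V1 V A s m s' \<Longrightarrow> is_state V1 V A s \<and> is_state V1 V A s'"
  unfolding game_step_def time_step_def by (auto split: prod.splits)

lemma last_state_is_state:
  assumes "is_run V1 V A (FinRun \<rho>)"
  shows "is_state V1 V A (last_state \<rho>)"
proof -
  obtain s es where \<rho>: "\<rho> = (s, es)" by (cases \<rho>)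
  show ?thesis
  proof (cases es rule: rev_cases)
    case Nil
    then show ?thesis using assms by (simp add: \<rho> is_run_def)
  next
    case (snoc es' e)
    then have "game_step V1 V A (last_state (s, es')) (fst e) (snd e)"
      using assms unfolding \<rho> is_run_def by (cases e) (auto simp: steps_of_snoc)
    then show ?thesis using game_step_is_state by (simp add: \<rho> snoc)
  qed
qed

lemma attr_strategy_good:
  assumes "is_run V1 V A (FinRun \<rho>)" and "attr_strategy \<rho> = Some m"
  shows "good_move (attr (rank (point (last_state \<rho>)) - 1)) (last_state \<rho>) m"
proof -
  let ?s = "last_state \<rho>"
  have "fst ?s \<notin> goal A" "\<exists>n. point ?s \<in> attr n"
    and m: "m = (SOME m. good_move (attr (rank (point ?s) - 1)) ?s m)"
    using assms(2) by (auto simp: attr_strategy_def Let_def split: if_splits)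
  then show ?thesis
    using good_move_ex[OF last_state_is_state[OF assms(1)]] in_cpre_rank(2)
    unfolding m by (meson someI_ex)
qed

lemma is_strategy_attr_strategy: "is_strategy V1 V A attr_strategy"
  unfolding is_strategy_def
  using attr_strategy_good good_move_enabled last_state_is_state by blast

lemma is_run_snocD:
  assumes "is_run V1 V A (FinRun (s, es @ [(m, s')]))"
  shows "is_run V1 V A (FinRun (s, es))" and "game_step V1 V A (last_state (s, es)) m s'"
  using assms by (auto simp: is_run_def steps_of_snoc)

lemma consistent_snocD:
  assumes "consistent A \<sigma> (FinRun (s, es @ [((\<tau>', a'), s')]))"
  shows "consistent A \<sigma> (FinRun (s, es))"
    and "\<sigma> (s, es) = Some (\<tau>, a) \<Longrightarrow> (\<tau>', a') = (\<tau>, a) \<or> \<tau>' \<le> \<tau> \<and> a' \<in> unctrl A"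
  using assms by (auto simp: consistent_def steps_of_snoc)

text \<open>Every consistent step, whether the chosen move or a preempting action, lands in the
  iterate below the current rank. The rank thus bounds the number of steps that can be played
  without meeting the goal.\<close>

lemma rank_decreases:
  assumes "is_run V1 V A (FinRun (s, es))" and "consistent A attr_strategy (FinRun (s, es))"
    and "\<not> winning_run A (FinRun (s, es))" and "point s \<in> attr n"
  shows "(\<exists>k. point (last_state (s, es)) \<in> attr k) \<and>
    rank (point (last_state (s, es))) + length es \<le> rank (point s)"
  using assms(1-3)
proof (induction es rule: rev_induct)
  case Nil
  then show ?case using assms(4) by auto
next
  case (snoc e es)
  let ?l = "last_state (s, es)"
  obtain \<tau>' a' s' where e: "e = ((\<tau>', a'), s')" by (cases e) auto
  note run = is_run_snocD[OF snoc.prems(1)[unfolded e]]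
  note cons = consistent_snocD[OF snoc.prems(2)[unfolded e]]
  have nw: "\<not> winning_run A (FinRun (s, es))"
    using snoc.prems(3) by (auto simp: winning_run_def)
  note IH = snoc.IH[OF run(1) cons(1) nw]
  have "?l \<in> states_of (FinRun (s, es))" by auto
  then have "fst ?l \<notin> goal A"
    using nw unfolding winning_run_def by (cases ?l) fastforce
  then obtain \<tau> a where m: "attr_strategy (s, es) = Some (\<tau>, a)"
    using IH unfolding attr_strategy_def Let_def by (metis surj_pair)
  have "point s' \<in> attr (rank (point ?l) - 1)"
    using good_move_step[OF attr_strategy_good[OF run(1) m] run(2) cons(2)[OF m]] .
  moreover have "0 < rank (point ?l)" using IH in_cpre_rank(1) by blast
  ultimately have "rank (point s') < rank (point ?l)"
    using rank_le by fastforce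
  then show ?case
    using IH \<open>point s' \<in> _\<close> by (auto simp: e)
qed

lemma attr_winning:
  assumes "s \<in> attr n"
  shows "s \<in> winning_states V1 V V2 A"
proof -
  have "winning_from V1 V A attr_strategy s"
  proof (cases s)
    case (Pair q y)
    have "winning_run A \<rho>" if run: "is_run V1 V A \<rho>" and fs: "first_state \<rho> = (q, x, t, y)"
        and cons: "consistent A attr_strategy \<rho>" and max: "maximal_run attr_strategy \<rho>" for x t \<rho>
    proof (rule ccontr)
      assume nw: "\<not> winning_run A \<rho>"
      show False
      proof (cases \<rho>)
        case (FinRun \<rho>')
        then obtain s0 es where \<rho>: "\<rho> = FinRun (s0, es)" by (cases \<rho>') auto
        with fs have s0: "s0 = (q, x, t, y)" by simp
        have "\<exists>k. point (last_state (s0, es)) \<in> attr k"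
          using rank_decreases[of s0 es n] run cons nw assms unfolding \<rho> s0 Pair by auto
        moreover have "last_state (s0, es) \<in> states_of \<rho>" by (auto simp: \<rho>)
        then have "fst (last_state (s0, es)) \<notin> goal A"
          using nw unfolding winning_run_def by (cases "last_state (s0, es)") fastforce
        ultimately have "attr_strategy (s0, es) \<noteq> None"
          unfolding attr_strategy_def Let_def by auto
        then show False using max by (simp add: \<rho> maximal_run_def)
      next
        case (InfRun s0 e)
        with fs have s0: "s0 = (q, x, t, y)" by simp
        \<comment> \<open>A prefix with one step more than the rank of its first point
          allows.\<close>
        let ?\<rho> = "FinRun (s0, map e [0..<Suc (rank (point s0))])"
        have steps: "steps_of ?\<rho> \<subseteq> steps_of \<rho>"
          unfolding InfRun steps_of_InfRun by blast
        have r: "is_run V1 V A ?\<rho>"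
          using run subsetD[OF steps] unfolding is_run_def by (simp add: InfRun)
        have c: "consistent A attr_strategy ?\<rho>"
          using cons steps unfolding consistent_def by blast
        have "states_of ?\<rho> \<subseteq> states_of \<rho>"
          unfolding InfRun by auto
        then have w: "\<not> winning_run A ?\<rho>"
          using nw unfolding winning_run_def by blast
        have "point s0 \<in> attr n" using assms by (simp add: s0 Pair)
        from conjunct2[OF rank_decreases[OF r c w this]] show False by simp
      qed
    qed
    then show ?thesis unfolding Pair winning_from_def by blast
  qed
  then show ?thesis
    using is_strategy_attr_strategy attr_subset assms unfolding winning_states_def by blast
qed

subsection \<open>The complement of a closed set is not winning\<close>

text \<open>A property of states rather than points: a point outside a closed \<open>W\<close>
  guarantees only some trajectory without a good time, and the opponent has to select that
  one.\<close>

definition bad :: "(nat \<times> 'm list) set \<Rightarrow> 'm state \<Rightarrow> bool" where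
  "bad W s \<longleftrightarrow> is_state V1 V A s \<and> fst s \<notin> goal A \<and> (\<forall>m. \<not> good_move W s m)"

lemma bad_ex:
  assumes "cpre W \<subseteq> W" and "s \<in> locs A \<times> V2" and "s \<notin> W"
  shows "\<exists>x\<in>V1. \<exists>t\<in>V. dyn A (fst s) x t = snd s \<and> bad W (fst s, x, t, snd s)"
proof -
  have "s \<notin> cpre W" using assms by blast
  then obtain x t where xt: "x \<in> V1" "t \<in> V" "dyn A (fst s) x t = snd s" "fst s \<notin> goal A"
    "\<forall>t'. \<not> good_time W (fst s) x t t'"
    using assms(2) unfolding cpre_def by blast
  then have "bad W (fst s, x, t, snd s)"
    using assms(2) unfolding bad_def good_move_def is_state_def by auto
  with xt show ?thesis by blast
qed

text \<open>A move that is not good fails in one of two ways: its action has a successor outside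
  \<open>W\<close>, or an uncontrollable action has one at some time up to the move. Either way the
  opponent reaches a point outside \<open>W\<close> and then picks a bad trajectory through
  it.\<close>

lemma bad_step:
  assumes W: "cpre W \<subseteq> W" and bad: "bad W s" and en: "enabled V1 V A (\<tau>, a) s" "0 \<le> \<tau>" "a \<in> ctrl A"
  shows "\<exists>\<tau>' a' s'. game_step V1 V A s (\<tau>', a') s' \<and> bad W s' \<and>
    ((\<tau>', a') = (\<tau>, a) \<or> \<tau>' \<le> \<tau> \<and> a' \<in> unctrl A)"
proof -
  obtain q x t y where s: "s = (q, x, t, y)" by (cases s)
  have st: "is_state V1 V A (q, x, t, y)" using bad by (simp add: bad_def s)
  have escape: "\<exists>s'. game_step V1 V A s (\<tau>', a') s' \<and> bad W s'"
    if "0 \<le> \<tau>'" "t + \<tau>' \<in> V" "disc_step A (q, dyn A q x (t + \<tau>')) a' p" "p \<notin> W" for \<tau>' a' p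
  proof -
    have p: "p \<in> locs A \<times> V2" using disc_step_closed that(3) by blast
    from bad_ex[OF W p that(4)] obtain x' t' where "x' \<in> V1" "t' \<in> V"
      "dyn A (fst p) x' t' = snd p" "bad W (fst p, x', t', snd p)" by auto
    moreover from this have "game_step V1 V A s (\<tau>', a') (fst p, x', t', snd p)"
      using that st p unfolding s game_step_def time_step_def is_state_def by auto
    ultimately show ?thesis by blast
  qed
  obtain q' x' t' y' where step: "disc_step A (q, dyn A q x (t + \<tau>)) a (q', y')" "t + \<tau> \<in> V"
    "is_state V1 V A (q', x', t', y')"
    using en(1) unfolding enabled_def s game_step_def time_step_def is_state_def by auto
  have "\<not> good_move W s (\<tau>, a)" using bad by (simp add: bad_def)
  then consider (ctl) "\<not> forces W a (q, dyn A q x (t + \<tau>))"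
    | (unc) t'' where "t'' \<in> V" "t \<le> t''" "t'' \<le> t + \<tau>" "\<not> safe W (q, dyn A q x t'')"
    using en(2,3) step(2) unfolding s good_move_def good_time_def by (auto simp: grp_le_add_same)
  then show ?thesis
  proof cases
    case ctl
    \<comment> \<open>Enabledness already provides an alive successor, so \<open>forces\<close> can
      fail only through a successor outside \<open>W\<close>.\<close>
    have "alive (q', y')" using step(3) by (auto simp: is_state_def alive_def)
    then obtain p where "disc_step A (q, dyn A q x (t + \<tau>)) a p" "p \<notin> W"
      using ctl step(1) unfolding forces_def by blast
    then show ?thesis using escape[OF en(2) step(2)] by blast
  next
    case unc
    then obtain u p where u: "u \<in> unctrl A" "disc_step A (q, dyn A q x t'') u p" "p \<notin> W"
      unfolding safe_def by auto
    have t'': "t + (- t + t'') = t''" by (simp add: add.assoc[symmetric])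
    then have "0 \<le> - t + t''" "- t + t'' \<le> \<tau>"
      using unc grp_le_add_same[of t "- t + t''"] grp_add_le_cancel_left[of t "- t + t''" \<tau>] by auto
    then show ?thesis using escape[of "- t + t''" u p] u unc(1) unfolding t'' by meson
  qed
qed

text \<open>Bad states lie outside the goal, so it is enough to visit only such states. Either some
  consistent play of this kind reaches a history where the strategy is undefined, and that play is
  maximal, or every such play can be prolonged, which gives an infinite one.\<close>

lemma bad_not_winning:
  assumes W: "cpre W \<subseteq> W" and bad: "bad W s" and \<sigma>: "is_strategy V1 V A \<sigma>"
  shows "\<exists>\<rho>. is_run V1 V A \<rho> \<and> first_state \<rho> = s \<and> consistent A \<sigma> \<rho> \<and> maximal_run \<sigma> \<rho> \<and>
    \<not> winning_run A \<rho>"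
proof -
  define ok where "ok es \<longleftrightarrow> is_run V1 V A (FinRun (s, es)) \<and> consistent A \<sigma> (FinRun (s, es)) \<and>
    (\<forall>s'\<in>states_of (FinRun (s, es)). bad W s')" for es
  have bad_goal: "\<not> winning_run A \<rho>" if "\<forall>s'\<in>states_of \<rho>. bad W s'" for \<rho>
    using that unfolding winning_run_def bad_def by fastforce
  have ok_Nil: "ok []"
    using bad by (simp add: ok_def is_run_def consistent_def steps_of_Nil bad_def)
  show ?thesis
  proof (cases "\<exists>es. ok es \<and> \<sigma> (s, es) = None")
    case True
    then obtain es where "ok es" "\<sigma> (s, es) = None" by blast
    then show ?thesis
      using bad_goal by (intro exI[of _ "FinRun (s, es)"]) (auto simp: ok_def maximal_run_def)
  next
    case False
    have "\<exists>e. ok (es @ [e])" if es: "ok es" for es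
    proof -
      obtain \<tau> a where m: "\<sigma> (s, es) = Some (\<tau>, a)" using False es by fastforce
      have run: "is_run V1 V A (FinRun (s, es))" using es by (simp add: ok_def)
      have "last_state (s, es) \<in> states_of (FinRun (s, es))" by auto
      then have "bad W (last_state (s, es))" using es unfolding ok_def by blast
      moreover have "0 \<le> \<tau>" "a \<in> ctrl A" "enabled V1 V A (\<tau>, a) (last_state (s, es))"
        using \<sigma> run m unfolding is_strategy_def by blast+
      ultimately obtain \<tau>' a' s' where "game_step V1 V A (last_state (s, es)) (\<tau>', a') s'" "bad W s'"
        "(\<tau>', a') = (\<tau>, a) \<or> \<tau>' \<le> \<tau> \<and> a' \<in> unctrl A"
        using bad_step[OF W] by meson
      then have "ok (es @ [((\<tau>', a'), s')])"
        using es m unfolding ok_def is_run_def consistent_def steps_of_snoc by auto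
      then show ?thesis by blast
    qed
    \<comment> \<open>Dependent choice on whole histories, since \<open>\<sigma>\<close> need not be
      positional.\<close>
    then obtain E where E: "\<And>es. ok es \<Longrightarrow> ok (es @ [E es])" by metis
    define pre where "pre n = ((\<lambda>es. es @ [E es]) ^^ n) []" for n
    define e where "e n = E (pre n)" for n
    have "pre n = map e [0..<n]" for n
      by (induction n) (auto simp: pre_def e_def)
    moreover have "ok (pre n)" for n
      by (induction n) (auto simp: pre_def ok_Nil intro: E)
    ultimately have ok: "ok (map e [0..<n])" for n by simp
    have "is_run V1 V A (InfRun s e)" "consistent A \<sigma> (InfRun s e)"
      using ok unfolding is_run_def consistent_def steps_of_InfRun ok_def by auto
    moreover have "bad W s'" if "s' \<in> states_of (InfRun s e)" for s'
    proof -
      from that consider "s' = s" | n where "s' = snd (e n)" by auto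
      then show ?thesis
      proof cases
        case 2
        then show ?thesis using ok[of "Suc n"] unfolding ok_def by auto
      qed (use bad in simp)
    qed
    ultimately show ?thesis
      using bad_goal by (intro exI[of _ "InfRun s e"]) (auto simp: maximal_run_def)
  qed
qed

lemma winning_states_subset:
  assumes "cpre W \<subseteq> W"
  shows "winning_states V1 V V2 A \<subseteq> W"
proof
  fix s assume "s \<in> winning_states V1 V V2 A"
  then obtain \<sigma> where s: "s \<in> locs A \<times> V2" and \<sigma>: "is_strategy V1 V A \<sigma>" "winning_from V1 V A \<sigma> s"
    unfolding winning_states_def by blast
  show "s \<in> W"
  proof (rule ccontr)
    assume "s \<notin> W"
    then obtain x t where xt: "x \<in> V1" "t \<in> V" "dyn A (fst s) x t = snd s"
      and bad: "bad W (fst s, x, t, snd s)"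
      using bad_ex[OF assms s] by blast
    show False
      using bad_not_winning[OF assms bad \<sigma>(1)] \<sigma>(2) xt unfolding winning_from_def
      by (cases s) auto
  qed
qed

lemma winning_states_eq_attr:
  assumes "attr (Suc n) \<subseteq> attr n"
  shows "winning_states V1 V V2 A = attr n"
  using winning_states_subset[of "attr n"] attr_winning assms by auto

end

section \<open>Stabilisation of the attractor\<close>

locale stable_game = game_arena V1 V V2 A
  for V1 :: "'m::ordered_grp list set" and V :: "'m set" and V2 :: "'m list set" and A :: "'m game" +
  fixes P :: "(nat \<times> 'm list) set set"
  assumes part: "partition_on (locs A \<times> V2) P"
    and fin: "finite P"
    and suf_stable: "suffix_stable V1 V V2 A P"
    and pred_stable: "a \<in> actions A \<Longrightarrow> stable_under_Pred V2 A P a"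
begin

section \<open>Pieces as classes of the suffix equivalence\<close>

definition E :: "((nat \<times> 'm list) \<times> (nat \<times> 'm list)) set" where
  "E = Suf_equiv V1 V V2 A P"

lemma E_iff: "(s, s') \<in> E \<longleftrightarrow> s \<in> locs A \<times> V2 \<and> s' \<in> locs A \<times> V2 \<and> fst s = fst s' \<and>
    Suf V1 V A P s = Suf V1 V A P s'"
  by (simp add: E_def Suf_equiv_def)

lemma equiv_E: "equiv (locs A \<times> V2) E"
  by (rule equivI) (auto simp: E_iff refl_on_def sym_def trans_def)

lemma pieces_eq_quotient: "(locs A \<times> V2) // E = P"
  using suf_stable by (simp add: suffix_stable_def Suf_partition_def E_def)

text \<open>By suffix stability the pieces are the classes of \<open>E\<close>, so being a union of
  pieces means being saturated under \<open>E\<close>. This is the form in which stability is used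
  below.\<close>

lemma union_of_pieces_iff:
  "union_of_pieces P W \<longleftrightarrow> W \<subseteq> locs A \<times> V2 \<and> (\<forall>s s'. (s, s') \<in> E \<longrightarrow> s \<in> W \<longrightarrow> s' \<in> W)"
proof
  assume "union_of_pieces P W"
  then obtain S where S: "S \<subseteq> P" "W = \<Union>S" unfolding union_of_pieces_def by blast
  then show "W \<subseteq> locs A \<times> V2 \<and> (\<forall>s s'. (s, s') \<in> E \<longrightarrow> s \<in> W \<longrightarrow> s' \<in> W)"
    using partition_onD1[OF part] in_quotient_imp_closed[OF equiv_E, unfolded pieces_eq_quotient] by blast
next
  assume W: "W \<subseteq> locs A \<times> V2 \<and> (\<forall>s s'. (s, s') \<in> E \<longrightarrow> s \<in> W \<longrightarrow> s' \<in> W)"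
  have "W = \<Union>((\<lambda>s. E `` {s}) ` W)"
    using W equiv_class_self[OF equiv_E] by auto
  moreover have "(\<lambda>s. E `` {s}) ` W \<subseteq> P"
    using W quotientI[of _ "locs A \<times> V2" E] unfolding pieces_eq_quotient by (meson image_subsetI subsetD)
  ultimately show "union_of_pieces P W" unfolding union_of_pieces_def by blast
qed

lemma union_of_pieces_cong: "union_of_pieces P W \<Longrightarrow> (s, s') \<in> E \<Longrightarrow> s \<in> W \<longleftrightarrow> s' \<in> W"
  unfolding union_of_pieces_iff by (metis E_iff)

lemma same_piece_E: "p \<in> P \<Longrightarrow> s \<in> p \<Longrightarrow> s' \<in> p \<Longrightarrow> (s, s') \<in> E"
  using in_quotient_imp_in_rel[OF equiv_E, unfolded pieces_eq_quotient] by blast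

lemma Pred_cong:
  assumes "a \<in> actions A" and "union_of_pieces P W" and "(s, s') \<in> E"
  shows "s \<in> Pred V2 A a W \<longleftrightarrow> s' \<in> Pred V2 A a W"
  using pred_stable[OF assms(1)] assms(2) union_of_pieces_cong[OF _ assms(3)]
  unfolding stable_under_Pred_def by simp

text \<open>Each trajectory through a point contributes a word, so a point is dead exactly if its
  suffix abstraction is empty.\<close>

lemma alive_cong: "(s, s') \<in> E \<Longrightarrow> alive s \<longleftrightarrow> alive s'"
proof -
  have "alive s \<longleftrightarrow> Suf V1 V A P s \<noteq> {}" for s
    by (cases s) (auto simp: alive_def Suf_def)
  then show "(s, s') \<in> E \<Longrightarrow> alive s \<longleftrightarrow> alive s'"
    by (simp add: E_iff)
qed

text \<open>\<open>Pred\<close> asks for a successor, but not for an alive one. If there is a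
  successor at all, one is alive unless all are dead, so the missing condition is the negation of a
  second \<open>Pred\<close>, taken of the set of dead points, which is itself a union of
  pieces.\<close>

lemma forces_cong:
  assumes "a \<in> ctrl A" and "union_of_pieces P W" and "(s, s') \<in> E"
  shows "forces W a s \<longleftrightarrow> forces W a s'"
proof -
  let ?D = "{s \<in> locs A \<times> V2. \<not> alive s}"
  have a: "a \<in> actions A" using assms(1) by (simp add: actions_def)
  have D: "union_of_pieces P ?D"
    using alive_cong E_iff unfolding union_of_pieces_iff by blast
  have "forces W a s \<longleftrightarrow> s \<in> Pred V2 A a W \<and> s \<notin> Pred V2 A a ?D" for s
    using disc_step_closed[of s a] unfolding forces_def Pred_def mem_Collect_eq by metis
  then show ?thesis using Pred_cong[OF a assms(2,3)] Pred_cong[OF a D assms(3)] by simp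
qed

text \<open>Safety holds vacuously where an action has no successor, whereas \<open>Pred\<close>
  fails there. \<open>Pred\<close> of the whole space tells the two cases apart.\<close>

lemma safe_cong:
  assumes "union_of_pieces P W" and "(s, s') \<in> E"
  shows "safe W s \<longleftrightarrow> safe W s'"
proof -
  have T: "union_of_pieces P (locs A \<times> V2)"
    unfolding union_of_pieces_iff by (auto simp: E_iff)
  have "safe W s \<longleftrightarrow> (\<forall>u\<in>unctrl A. s \<in> Pred V2 A u W \<or> s \<notin> Pred V2 A u (locs A \<times> V2))" for s
    using disc_step_closed[of s] unfolding safe_def Pred_def mem_Collect_eq by metis
  moreover have "u \<in> actions A" if "u \<in> unctrl A" for u using that by (simp add: actions_def)
  ultimately show ?thesis using Pred_cong[OF _ assms] Pred_cong[OF _ T assms(2)] by simp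
qed

subsection \<open>Maximal homogeneous intervals\<close>

lemma piece_unique:
  assumes "p \<in> P" "p' \<in> P" "s \<in> p" "s \<in> p'"
  shows "p = p'"
  using assms partition_onD2[OF part] unfolding disjoint_def by blast

lemma piece_ex: "q \<in> locs A \<Longrightarrow> x \<in> V1 \<Longrightarrow> t \<in> V \<Longrightarrow> \<exists>p\<in>P. (q, dyn A q x t) \<in> p"
  using dyn_closed partition_onD1[OF part] by blast

text \<open>No maximality principle is involved: all homogeneous sets through \<open>t\<close> carry
  the piece of \<open>t\<close>, and convex sets with a common time have a convex union, so the
  union of all of them is the largest one.\<close>

lemma max_interval_ex:
  assumes "q \<in> locs A" "x \<in> V1" "t \<in> V"
  shows "\<exists>I\<in>max_intervals V A P q x. t \<in> I"
proof -
  let ?I = "\<Union>{I. homogeneous V A P q x I \<and> t \<in> I}"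
  obtain p where p: "p \<in> P" "(q, dyn A q x t) \<in> p" using piece_ex[OF assms] by blast
  have p': "(q, dyn A q x t') \<in> p" if "homogeneous V A P q x I" "t \<in> I" "t' \<in> I" for I t'
    using that p piece_unique unfolding homogeneous_def by metis
  have "homogeneous V A P q x {t}"
    using p assms(3) by (auto simp: homogeneous_def)
  then have t: "t \<in> ?I" by blast
  have "{a..b} \<subseteq> ?I" if ab: "a \<in> ?I" "b \<in> ?I" for a b
  proof
    fix c assume c: "c \<in> {a..b}"
    obtain I J where I: "homogeneous V A P q x I" "t \<in> I" "a \<in> I"
      and J: "homogeneous V A P q x J" "t \<in> J" "b \<in> J" using ab by blast
    show "c \<in> ?I"
    proof (cases "c \<le> t")
      case True
      then have "c \<in> {a..t}" using c by simp
      then have "c \<in> I" using I unfolding homogeneous_def by blast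
      then show ?thesis using I by blast
    next
      case False
      then have "c \<in> {t..b}" using c by simp
      then have "c \<in> J" using J unfolding homogeneous_def by blast
      then show ?thesis using J by blast
    qed
  qed
  moreover have "?I \<subseteq> V" unfolding homogeneous_def by blast
  moreover have "\<forall>t'\<in>?I. (q, dyn A q x t') \<in> p" using p' by blast
  ultimately have hom: "homogeneous V A P q x ?I"
    using t p(1) unfolding homogeneous_def[of _ _ _ _ _ ?I] by auto
  have "J = ?I" if "homogeneous V A P q x J" "?I \<subseteq> J" for J
    using that t by blast
  then have "?I \<in> max_intervals V A P q x" using hom unfolding max_intervals_def by blast
  with t show ?thesis by (rule bexI)
qed

text \<open>A common time forces a common piece, so the union of both intervals is homogeneous and
  maximality makes it equal to each.\<close>

lemma max_interval_unique:
  assumes I: "I \<in> max_intervals V A P q x" and J: "J \<in> max_intervals V A P q x"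
    and t: "t \<in> I" "t \<in> J"
  shows "I = J"
proof -
  have hI: "homogeneous V A P q x I" and hJ: "homogeneous V A P q x J"
    using I J by (auto simp: max_intervals_def)
  obtain p where p: "p \<in> P" "\<forall>t\<in>I. (q, dyn A q x t) \<in> p" using hI unfolding homogeneous_def by blast
  obtain p' where p': "p' \<in> P" "\<forall>t\<in>J. (q, dyn A q x t) \<in> p'" using hJ unfolding homogeneous_def by blast
  have "p = p'" using piece_unique p p' t by blast
  then have pU: "\<forall>t\<in>I \<union> J. (q, dyn A q x t) \<in> p" using p p' by blast
  have "{a..b} \<subseteq> I \<union> J" if ab: "a \<in> I \<union> J" "b \<in> I \<union> J" for a b
  proof
    fix c assume c: "c \<in> {a..b}"
    have cI: "{a..b} \<subseteq> I" if "a \<in> I" "b \<in> I" for a b using hI that unfolding homogeneous_def by blast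
    have cJ: "{a..b} \<subseteq> J" if "a \<in> J" "b \<in> J" for a b using hJ that unfolding homogeneous_def by blast
    show "c \<in> I \<union> J"
    proof (cases "c \<le> t")
      case True
      then have "c \<in> {a..t}" using c by simp
      then show ?thesis using ab(1) cI[of a t] cJ[of a t] t by blast
    next
      case False
      then have "c \<in> {t..b}" using c by simp
      then show ?thesis using ab(2) cI[of t b] cJ[of t b] t by blast
    qed
  qed
  then have "homogeneous V A P q x (I \<union> J)"
    using hI hJ p(1) pU unfolding homogeneous_def by blast
  then have "I \<union> J = I" "I \<union> J = J" using I J unfolding max_intervals_def by blast+
  then show ?thesis by blast
qed

lemma suffix_interval_ex:
  assumes "q \<in> locs A" "x \<in> V1" "t' \<in> V" "t \<le> t'"
  shows "\<exists>I\<in>suffix_intervals V A P q x t. t' \<in> I"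
proof -
  obtain I where I: "I \<in> max_intervals V A P q x" "t' \<in> I"
    using max_interval_ex[OF assms(1-3)] by blast
  then have "t' \<in> I \<inter> {t' \<in> V. t \<le> t'}" using assms(3,4) by simp
  moreover from this have "I \<inter> {t' \<in> V. t \<le> t'} \<in> suffix_intervals V A P q x t"
    using I(1) unfolding suffix_intervals_def by blast
  ultimately show ?thesis by (rule bexI)
qed

lemma suffix_interval_unique:
  assumes "I \<in> suffix_intervals V A P q x t" "J \<in> suffix_intervals V A P q x t" "t' \<in> I" "t' \<in> J"
  shows "I = J"
proof -
  obtain I' where I': "I' \<in> max_intervals V A P q x" "I = I' \<inter> {t' \<in> V. t \<le> t'}"
    using assms(1) unfolding suffix_intervals_def by blast
  obtain J' where J': "J' \<in> max_intervals V A P q x" "J = J' \<inter> {t' \<in> V. t \<le> t'}"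
    using assms(2) unfolding suffix_intervals_def by blast
  have "I' = J'" using max_interval_unique[OF I'(1) J'(1), of t'] assms(3,4) I'(2) J'(2) by simp
  then show ?thesis using I'(2) J'(2) by simp
qed

lemma suffix_intervalD:
  assumes "I \<in> suffix_intervals V A P q x t"
  shows "I \<noteq> {}" and "t' \<in> I \<Longrightarrow> t' \<in> V \<and> t \<le> t'"
    and "a \<in> I \<Longrightarrow> b \<in> I \<Longrightarrow> {a..b} \<subseteq> I"
    and "\<exists>p\<in>P. \<forall>t'\<in>I. (q, dyn A q x t') \<in> p"
proof -
  obtain J where J: "homogeneous V A P q x J" and I: "I = J \<inter> {t' \<in> V. t \<le> t'}" and ne: "I \<noteq> {}"
    using assms unfolding suffix_intervals_def max_intervals_def by blast
  show "I \<noteq> {}" by (rule ne)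
  show "t' \<in> I \<Longrightarrow> t' \<in> V \<and> t \<le> t'" using I by blast
  show "\<exists>p\<in>P. \<forall>t'\<in>I. (q, dyn A q x t') \<in> p" using J I unfolding homogeneous_def by blast
  assume ab: "a \<in> I" "b \<in> I"
  then have "{a..b} \<subseteq> J" using J I unfolding homogeneous_def by blast
  moreover have "J \<subseteq> V" using J unfolding homogeneous_def by blast
  ultimately show "{a..b} \<subseteq> I" using ab I by auto
qed

lemma piece_along_contains:
  assumes "I \<in> suffix_intervals V A P q x t" and "t' \<in> I"
  shows "piece_along A P q x I \<in> P" and "(q, dyn A q x t') \<in> piece_along A P q x I"
proof -
  obtain p where p: "p \<in> P \<and> (\<forall>t\<in>I. (q, dyn A q x t) \<in> p)"
    using suffix_intervalD(4)[OF assms(1)] by blast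
  have "piece_along A P q x I = p"
    unfolding piece_along_def
  proof (rule the_equality, rule p)
    show "p' = p" if "p' \<in> P \<and> (\<forall>t\<in>I. (q, dyn A q x t) \<in> p')" for p'
      using piece_unique that p assms(2) by blast
  qed
  then show "piece_along A P q x I \<in> P" "(q, dyn A q x t') \<in> piece_along A P q x I"
    using p assms(2) by auto
qed

text \<open>Disjoint convex sets cannot interleave, so a single comparison \<open>a \<le> b\<close>
  settles the order of the whole intervals.\<close>

lemma suffix_intervals_ordered:
  assumes I: "I \<in> suffix_intervals V A P q x t" and J: "J \<in> suffix_intervals V A P q x t"
    and ab: "a \<in> I" "b \<in> J" "a \<le> b" and "I \<noteq> J"
  shows "(I, J) \<in> interval_order"
proof -
  have disj: "c \<notin> J" if "c \<in> I" for c using suffix_interval_unique[OF I J that] \<open>I \<noteq> J\<close> by blast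
  have "a' < b'" if a': "a' \<in> I" and b': "b' \<in> J" for a' b'
  proof (rule ccontr)
    assume "\<not> a' < b'"
    then consider "b' \<le> a" | "a \<le> b'" "b' \<le> a'" by fastforce
    then show False
    proof cases
      case 1
      then have "a \<in> {b'..b}" using ab by simp
      then show False using suffix_intervalD(3)[OF J b' ab(2)] disj[OF ab(1)] by blast
    next
      case 2
      then have "b' \<in> {a..a'}" by simp
      then show False using suffix_intervalD(3)[OF I ab(1) a'] disj b' by blast
    qed
  qed
  then show ?thesis unfolding interval_order_def by blast
qed

subsection \<open>Suffix words determine the controllable predecessor\<close>

lemma suffix_word_iso:
  assumes "suffix_word V A P q x t = suffix_word V A P q x' t'"
  shows "labelled_iso (suffix_intervals V A P q x t, interval_order, piece_along A P q x)
    (suffix_intervals V A P q x' t', interval_order, piece_along A P q x')"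
proof -
  have "labelled_iso w w" for w :: "('m set, (nat \<times> 'm list) set) labelled_order"
    unfolding labelled_iso_def by (cases w) (auto intro!: exI[of _ "\<lambda>i. i"] simp: bij_betw_def)
  then show ?thesis using assms unfolding suffix_word_def word_of_def by blast
qed

text \<open>The isomorphism matches intervals and not times, so \<open>u\<close> is replaced by an
  arbitrary \<open>u'\<close> in the image of its interval \<open>I\<close>. The pieces agree, hence
  the same action forces \<open>W\<close> there. An earlier time \<open>r'\<close> lies in the image
  of \<open>I\<close> or of an interval before \<open>I\<close>; that interval contains a time up to
  \<open>u\<close>, which is safe, and safety is constant on pieces.\<close>

lemma good_time_transfer:
  assumes q: "q \<in> locs A" and x: "x \<in> V1" and x': "x' \<in> V1"
    and word: "suffix_word V A P q x t = suffix_word V A P q x' t'"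
    and W: "union_of_pieces P W" and good: "good_time W q x t u"
  shows "\<exists>u'. good_time W q x' t' u'"
proof -
  let ?S = "suffix_intervals V A P q x t" and ?S' = "suffix_intervals V A P q x' t'"
  obtain f where bij: "bij_betw f ?S ?S'"
    and ord: "\<And>I J. I \<in> ?S \<Longrightarrow> J \<in> ?S \<Longrightarrow> (I, J) \<in> interval_order \<longleftrightarrow> (f I, f J) \<in> interval_order"
    and lab: "\<And>I. I \<in> ?S \<Longrightarrow> piece_along A P q x I = piece_along A P q x' (f I)"
    using suffix_word_iso[OF word] unfolding labelled_iso_def by auto
  have f: "f I \<in> ?S'" if "I \<in> ?S" for I using bij that by (auto simp: bij_betw_def)
  have EI: "((q, dyn A q x r), (q, dyn A q x' r')) \<in> E" if "I \<in> ?S" "r \<in> I" "r' \<in> f I" for I r r'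
    using piece_along_contains[OF that(1,2)] piece_along_contains[OF f[OF that(1)] that(3)]
      lab[OF that(1)] same_piece_E by metis
  have u: "u \<in> V" "t \<le> u" using good by (auto simp: good_time_def)
  obtain I where I: "I \<in> ?S" "u \<in> I" using suffix_interval_ex[OF q x u] by blast
  obtain u' where u': "u' \<in> f I" using suffix_intervalD(1)[OF f[OF I(1)]] by blast
  have "safe W (q, dyn A q x' r')" if r': "r' \<in> V" "t' \<le> r'" "r' \<le> u'" for r'
  proof -
    obtain J' where J': "J' \<in> ?S'" "r' \<in> J'" using suffix_interval_ex[OF q x' r'(1,2)] by blast
    obtain J where J: "J \<in> ?S" "f J = J'"
      using J'(1) unfolding bij_betw_imp_surj_on[OF bij, symmetric] by (rule imageE) simp
    \<comment> \<open>One such time is enough. For \<open>J = I\<close> it is \<open>u\<close>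
      itself, even if \<open>I\<close> begins earlier or extends beyond \<open>u\<close>.\<close>
    have "\<exists>r\<in>J. r \<le> u"
    proof (cases "J = I")
      case True
      then show ?thesis using I by blast
    next
      case False
      then have "J' \<noteq> f I" using inj_onD[OF bij_betw_imp_inj_on[OF bij] _ J(1) I(1)] J(2) by metis
      then have "(f J, f I) \<in> interval_order"
        using suffix_intervals_ordered[OF J'(1) f[OF I(1)] J'(2) u' r'(3)] J(2) by simp
      then have "(J, I) \<in> interval_order" using ord J I by blast
      then show ?thesis using suffix_intervalD(1)[OF J(1)] I(2) unfolding interval_order_def by force
    qed
    then obtain r where r: "r \<in> J" "r \<le> u" by blast
    then have "safe W (q, dyn A q x r)"
      using good suffix_intervalD(2)[OF J(1) r(1)] by (simp add: good_time_def)
    then show ?thesis using safe_cong[OF W EI[OF J(1) r(1), of r']] J J' by simp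
  qed
  moreover obtain a where "a \<in> ctrl A" "forces W a (q, dyn A q x u)"
    using good unfolding good_time_def by blast
  then have "\<exists>a\<in>ctrl A. forces W a (q, dyn A q x' u')"
    using forces_cong[OF _ W EI[OF I u']] by blast
  moreover have "u' \<in> V" "t' \<le> u'" using suffix_intervalD(2)[OF f[OF I(1)] u'] by auto
  ultimately show ?thesis unfolding good_time_def by blast
qed

text \<open>Equal suffix sets match every trajectory through \<open>y'\<close> with a trajectory
  through \<open>y\<close> having the same word, and a good time is carried over from the
  latter.\<close>

lemma union_of_pieces_cpre:
  assumes W: "union_of_pieces P W"
  shows "union_of_pieces P (cpre W)"
  unfolding union_of_pieces_iff
proof (intro conjI allI impI)
  show "cpre W \<subseteq> locs A \<times> V2" by (auto simp: cpre_def)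
  fix s s' assume e: "(s, s') \<in> E" and s: "s \<in> cpre W"
  obtain q y y' where sq: "s = (q, y)" "s' = (q, y')"
    using e by (cases s; cases s') (auto simp: E_iff)
  have q: "q \<in> locs A" "y' \<in> V2" and suf: "Suf V1 V A P (q, y) = Suf V1 V A P (q, y')"
    using e by (auto simp: E_iff sq)
  have "q \<in> goal A \<or> (\<exists>u. good_time W q x' t' u)" if x': "x' \<in> V1" "t' \<in> V" "dyn A q x' t' = y'" for x' t'
  proof -
    have "suffix_word V A P q x' t' \<in> Suf V1 V A P (q, y)"
      unfolding suf using x' by (auto simp: Suf_def)
    then obtain x t where xt: "x \<in> V1" "t \<in> V" "dyn A q x t = y"
      "suffix_word V A P q x t = suffix_word V A P q x' t'"
      unfolding Suf_def by auto
    then have "q \<in> goal A \<or> (\<exists>u. good_time W q x t u)"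
      using s unfolding sq cpre_def by auto
    then show ?thesis using good_time_transfer[OF q(1) xt(1) x'(1) xt(4) W] by blast
  qed
  then show "s' \<in> cpre W" using q unfolding sq cpre_def by simp
qed

lemma union_of_pieces_attr: "union_of_pieces P (attr n)"
proof (induction n)
  case 0
  then show ?case by (simp add: union_of_pieces_iff)
qed (simp add: union_of_pieces_cpre)

text \<open>Finitely many pieces have finitely many unions, so two iterates coincide; by
  monotonicity all iterates between them are equal.\<close>

lemma attr_stabilises: "\<exists>n. attr (Suc n) \<subseteq> attr n"
proof -
  have "range attr \<subseteq> Union ` Pow P"
    using union_of_pieces_attr unfolding union_of_pieces_def by blast
  then have "finite (range attr)" using fin by (meson finite_Pow_iff finite_imageI finite_subset)
  then have "\<not> inj attr" using finite_imageD infinite_UNIV_nat by blast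
  then obtain m n where "m < n" "attr m = attr n"
    unfolding inj_def by (metis linorder_neqE_nat)
  moreover have "attr (Suc m) \<subseteq> attr n"
    using lift_Suc_mono_le[of attr, OF attr_Suc_mono] \<open>m < n\<close> Suc_leI by blast
  ultimately show ?thesis by metis
qed

end

section \<open>Formulas for the attractor\<close>

lemma val_cong: "(\<And>i. i \<in> fv_tm t \<Longrightarrow> e i = e' i) \<Longrightarrow> val M e t = val M e' t"
proof (induction t)
  case (Fun f ts)
  have "map (val M e) ts = map (val M e') ts"
    by (rule map_cong[OF refl]) (use Fun in auto)
  then show ?case by (simp only: val.simps)
next
  case (Plus s t)
  have "val M e s = val M e' s" "val M e t = val M e' t"
    using Plus by auto
  then show ?case by simp
qed auto

lemma sat_cong: "(\<And>i. i \<in> fv_fm \<phi> \<Longrightarrow> e i = e' i) \<Longrightarrow> sat M e \<phi> \<longleftrightarrow> sat M e' \<phi>"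
proof (induction \<phi> arbitrary: e e')
  case (Eq s t)
  then have "val M e s = val M e' s" "val M e t = val M e' t" by (auto intro: val_cong)
  then show ?case by simp
next
  case (Less s t)
  then have "val M e s = val M e' s" "val M e t = val M e' t" by (auto intro: val_cong)
  then show ?case by simp
next
  case (Rel r ts)
  have "map (val M e) ts = map (val M e') ts"
    by (rule map_cong[OF refl]) (use Rel in \<open>auto intro: val_cong\<close>)
  then show ?case by (simp only: sat.simps)
next
  case (Neg \<phi>)
  then show ?case by (metis fv_fm.simps(4) sat.simps(4))
next
  case (Conj \<phi> \<psi>)
  have "sat M e \<phi> = sat M e' \<phi>" "sat M e \<psi> = sat M e' \<psi>"
    using Conj.prems by (auto intro!: Conj.IH)
  then show ?case by simp
next
  case (Ex i \<phi>)
  have "sat M (e(i := a)) \<phi> \<longleftrightarrow> sat M (e'(i := a)) \<phi>" for a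
    using Ex.prems by (intro Ex.IH) auto
  then show ?case by simp
qed

text \<open>Uses built-in symbols only and is thus well formed over every language.\<close>

definition Fls :: fm where
  "Fls = Less Zero Zero"

lemma wf_Fls [simp]: "wf_fm M Fls"
  and fv_Fls [simp]: "fv_fm Fls = {}"
  by (simp_all add: Fls_def)

lemma sat_Fls [simp]: "\<not> sat M e Fls"
  by (simp add: Fls_def)

text \<open>A fold, so that on codes it is an iteration over a list known only to the machine;
  \<open>Neg\<close> and \<open>Conj\<close> because the syntax has no disjunction.\<close>

definition disjs :: "fm list \<Rightarrow> fm" where
  "disjs \<phi>s = fold (\<lambda>\<phi> \<psi>. Neg (Conj (Neg \<phi>) (Neg \<psi>))) \<phi>s Fls"

lemma wf_disjs [simp]: "wf_fm M (disjs \<phi>s) \<longleftrightarrow> (\<forall>\<phi>\<in>set \<phi>s. wf_fm M \<phi>)"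
proof -
  have "wf_fm M (fold (\<lambda>\<phi> \<psi>. Neg (Conj (Neg \<phi>) (Neg \<psi>))) \<phi>s \<psi>) \<longleftrightarrow>
      wf_fm M \<psi> \<and> (\<forall>\<phi>\<in>set \<phi>s. wf_fm M \<phi>)" for \<psi>
    by (induction \<phi>s arbitrary: \<psi>) auto
  then show ?thesis by (simp add: disjs_def)
qed

lemma fv_disjs [simp]: "fv_fm (disjs \<phi>s) = (\<Union>\<phi>\<in>set \<phi>s. fv_fm \<phi>)"
proof -
  have "fv_fm (fold (\<lambda>\<phi> \<psi>. Neg (Conj (Neg \<phi>) (Neg \<psi>))) \<phi>s \<psi>) =
      fv_fm \<psi> \<union> (\<Union>\<phi>\<in>set \<phi>s. fv_fm \<phi>)" for \<psi>
    by (induction \<phi>s arbitrary: \<psi>) auto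
  then show ?thesis by (simp add: disjs_def)
qed

lemma sat_disjs [simp]: "sat M e (disjs \<phi>s) \<longleftrightarrow> (\<exists>\<phi>\<in>set \<phi>s. sat M e \<phi>)"
proof -
  have "sat M e (fold (\<lambda>\<phi> \<psi>. Neg (Conj (Neg \<phi>) (Neg \<psi>))) \<phi>s \<psi>) \<longleftrightarrow>
      sat M e \<psi> \<or> (\<exists>\<phi>\<in>set \<phi>s. sat M e \<phi>)" for \<psi>
    by (induction \<phi>s arbitrary: \<psi>) auto
  then show ?thesis by (simp add: disjs_def)
qed

section \<open>Blocks of quantifiers and renaming of free variables\<close>

declare upt_Suc [simp del]

primrec exb :: "nat \<Rightarrow> nat \<Rightarrow> fm \<Rightarrow> fm" where
  "exb b 0 \<phi> = \<phi>"
| "exb b (Suc k) \<phi> = Ex (b + k) (exb b k \<phi>)"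

definition upd :: "(nat \<Rightarrow> 'm) \<Rightarrow> nat \<Rightarrow> 'm list \<Rightarrow> nat \<Rightarrow> 'm" where
  "upd e b xs i = (if b \<le> i \<and> i < b + length xs then xs ! (i - b) else e i)"

lemma wf_exb [simp]: "wf_fm M (exb b k \<phi>) = wf_fm M \<phi>"
  by (induction k) auto

lemma fv_exb [simp]: "fv_fm (exb b k \<phi>) = fv_fm \<phi> - {b..<b + k}"
proof (induction k)
  case 0
  show ?case by simp
next
  case (Suc k)
  have "{b..<b + Suc k} = insert (b + k) {b..<b + k}" by auto
  then show ?case using Suc by (simp only: exb.simps fv_fm.simps) blast
qed

lemma sat_exb [simp]: "sat M e (exb b k \<phi>) \<longleftrightarrow> (\<exists>xs. length xs = k \<and> sat M (upd e b xs) \<phi>)"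
proof (induction k arbitrary: e)
  case 0
  have "upd e b [] = e" by (auto simp: upd_def fun_eq_iff)
  then show ?case by simp
next
  case (Suc k)
  have *: "upd (e(b + k := a)) b xs = upd e b (xs @ [a])" if "length xs = k" for a xs
    using that by (auto simp: upd_def fun_eq_iff nth_append)
  have "sat M e (exb b (Suc k) \<phi>) \<longleftrightarrow>
      (\<exists>a xs. length xs = k \<and> sat M (upd (e(b + k := a)) b xs) \<phi>)"
    by (simp only: exb.simps sat.simps Suc)
  also have "\<dots> \<longleftrightarrow> (\<exists>a xs. length xs = k \<and> sat M (upd e b (xs @ [a])) \<phi>)"
    by (intro ex_cong1 conj_cong refl) (simp only: *)
  also have "\<dots> \<longleftrightarrow> (\<exists>xs. length xs = Suc k \<and> sat M (upd e b xs) \<phi>)"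
    by (metis length_Suc_conv_rev)
  finally show ?case .
qed

lemma map_upd [simp]: "length xs = k \<Longrightarrow> map (upd e b xs) [b..<b + k] = xs"
  by (rule nth_equalityI) (auto simp: upd_def)

lemma map_upd_disjoint: "j \<le> b \<or> b + length xs \<le> i \<Longrightarrow> map (upd e b xs) [i..<j] = map e [i..<j]"
  by (rule map_cong[OF refl]) (auto simp: upd_def)

text \<open>Instantiation of the free variables \<open>0, 1, \<dots>\<close> by the variables in \<open>vs\<close> without substitution:
  the values are copied to fresh variables, and from there to \<open>0, 1, \<dots>\<close>, by quantified equations.
  On codes this is a fixed sequence of constructors.\<close>

definition eqb :: "nat \<Rightarrow> nat list \<Rightarrow> fm" where
  "eqb b vs = Neg (disjs (map (\<lambda>i. Neg (Eq (Var (b + i)) (Var (vs ! i)))) [0..<length vs]))"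

definition inst :: "nat list \<Rightarrow> fm \<Rightarrow> fm" where
  "inst vs \<phi> = (let k = length vs; N = Suc (k + sum_list vs) in
    exb N k (Conj (eqb N vs) (exb 0 k (Conj (eqb 0 [N..<N + k]) \<phi>))))"

lemma wf_eqb [simp]: "wf_fm M (eqb b vs)"
  by (auto simp: eqb_def)

lemma fv_eqb [simp]: "fv_fm (eqb b vs) = {b..<b + length vs} \<union> set vs"
proof -
  have "fv_fm (eqb b vs) = (\<Union>i\<in>{0..<length vs}. {b + i, vs ! i})"
    unfolding eqb_def by (simp add: insert_commute)
  also have "\<dots> = (+) b ` {0..<length vs} \<union> (!) vs ` {0..<length vs}" by blast
  also have "\<dots> = {b..<b + length vs} \<union> set vs"
    by (auto simp: set_conv_nth)
  finally show ?thesis .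
qed

lemma sat_eqb [simp]: "sat M e (eqb b vs) \<longleftrightarrow> map e [b..<b + length vs] = map e vs"
proof -
  have "sat M e (eqb b vs) \<longleftrightarrow> (\<forall>i<length vs. e (b + i) = e (vs ! i))"
    unfolding eqb_def by (simp add: Ball_def)
  also have "\<dots> \<longleftrightarrow> map e [b..<b + length vs] = map e vs"
    by (simp only: list_eq_iff_nth_eq length_map length_upt nth_map nth_upt add_diff_cancel_left') auto
  finally show ?thesis .
qed

lemma wf_inst [simp]: "wf_fm M (inst vs \<phi>) = wf_fm M \<phi>"
  by (simp add: inst_def Let_def)

lemma fv_inst:
  assumes "fv_fm \<phi> \<subseteq> {..<length vs}"
  shows "fv_fm (inst vs \<phi>) \<subseteq> set vs"
proof -
  have "fv_fm \<phi> \<subseteq> {0..<length vs}" using assms by auto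
  then show ?thesis unfolding inst_def Let_def by (simp only: fv_exb fv_fm.simps fv_eqb set_upt length_upt) auto
qed

lemma sat_inst:
  assumes "fv_fm \<phi> \<subseteq> {..<length vs}"
  shows "sat M e (inst vs \<phi>) \<longleftrightarrow> sat M ((!) (map e vs)) \<phi>"
proof -
  let ?k = "length vs"
  \<comment> \<open>\<open>N\<close> exceeds every variable in \<open>vs\<close> and is at least
    \<open>?k\<close>, so the intermediate block meets neither source nor target. A direct copy
    could capture variables of \<open>vs\<close> that are themselves below
    \<open>?k\<close>.\<close>
  define N where "N = Suc (length vs + sum_list vs)"
  have "v < N" if "v \<in> set vs" for v
    using member_le_sum_list[OF that] by (simp add: N_def)
  then have vs: "map (upd e N xs) vs = map e vs" for xs
    by (intro map_cong refl) (metis upd_def leD)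
  have "?k \<le> N" by (simp add: N_def)
  then have 1: "map (upd (upd e N xs) 0 ys) [N..<N + ?k] = xs" if "length xs = ?k" "length ys = ?k" for xs ys
    using map_upd_disjoint[of "N + ?k" 0 ys N "upd e N xs"] map_upd[OF that(1), of e N] that(2) by simp
  have 2: "sat M (upd e' 0 ys) \<phi> \<longleftrightarrow> sat M ((!) ys) \<phi>" if "length ys = ?k" for e' ys
    using assms that by (intro sat_cong) (auto simp: upd_def)
  have 3: "map (upd e' 0 ys) [0..<?k] = ys" if "length ys = ?k" for e' ys
    using map_upd[OF that, of e' 0] by simp
  have "sat M e (inst vs \<phi>) \<longleftrightarrow> (\<exists>xs. length xs = ?k \<and> xs = map e vs \<and>
      (\<exists>ys. length ys = ?k \<and> ys = xs \<and> sat M ((!) ys) \<phi>))"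
    unfolding inst_def Let_def N_def[symmetric] sat_exb sat.simps sat_eqb length_upt
    by (intro ex_cong1 conj_cong refl) (simp_all add: vs 1 2 3)
  then show ?thesis by auto
qed

section \<open>Sets and their defining formulas\<close>

lemma fm_definesD:
  assumes "fm_defines M \<phi> k S"
  shows "wf_fm M \<phi>" and "fv_fm \<phi> \<subseteq> {..<k}" and "S = {xs. length xs = k \<and> sat M ((!) xs) \<phi>}"
  using assms unfolding fm_defines_def by (iprover elim: conjE)+

lemma sat_defines:
  assumes "fm_defines M \<phi> k S"
  shows "sat M e \<phi> \<longleftrightarrow> map e [0..<k] \<in> S"
proof -
  have "sat M e \<phi> \<longleftrightarrow> sat M ((!) (map e [0..<k])) \<phi>"
    using fm_definesD(2)[OF assms] by (intro sat_cong) auto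
  then show ?thesis using fm_definesD(3)[OF assms] by simp
qed

lemma sat_inst_defines:
  assumes "fm_defines M \<phi> k S" and "length vs = k"
  shows "sat M e (inst vs \<phi>) \<longleftrightarrow> map e vs \<in> S"
  using fm_definesD[OF assms(1)] assms(2) by (simp add: sat_inst)

lemma fv_inst_defines:
  assumes "fm_defines M \<phi> k S" and "length vs = k"
  shows "fv_fm (inst vs \<phi>) \<subseteq> set vs"
  using fv_inst fm_definesD(2)[OF assms(1)] assms(2) by simp

lemma fm_definesI:
  assumes "wf_fm M \<phi>" and "fv_fm \<phi> \<subseteq> {..<k}" and "\<And>xs. xs \<in> S \<Longrightarrow> length xs = k"
    and "\<And>xs. length xs = k \<Longrightarrow> sat M ((!) xs) \<phi> \<longleftrightarrow> xs \<in> S"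
  shows "fm_defines M \<phi> k S"
proof -
  have "xs \<in> S \<longleftrightarrow> length xs = k \<and> sat M ((!) xs) \<phi>" for xs
    using assms(3,4)[of xs] by blast
  then show ?thesis using assms(1,2) unfolding fm_defines_def by auto
qed

text \<open>Descriptions are lists and may name a location more than once. Under
  \<open>represents\<close> all entries of a location define the same slice, so their disjunction
  defines it too.\<close>

definition lookup :: "(nat \<times> fm) list \<Rightarrow> nat \<Rightarrow> fm" where
  "lookup F q = disjs (map (\<lambda>p. if fst p = q then snd p else Fls) F)"

definition neg_fms :: "(nat \<times> fm) list \<Rightarrow> (nat \<times> fm) list" where
  "neg_fms F = map (\<lambda>p. (fst p, Neg (snd p))) F"

section \<open>Formula constructors for one round of the iteration\<close>

context
  fixes k1 k2 :: nat
begin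

text \<open>The current point occupies the variables below \<open>k2\<close> and its successor the
  next \<open>k2\<close>. This is the only formula about discrete steps; \<open>forces_fm\<close>
  and \<open>unsafe_fm\<close> combine it for alive points and for complements.\<close>

definition succ_fm :: "game_desc \<Rightarrow> (nat \<times> fm) list \<Rightarrow> nat \<Rightarrow> nat \<Rightarrow> fm" where
  "succ_fm d F q a = disjs (map (\<lambda>tr.
    if fst tr = q \<and> fst (snd (snd tr)) = a
    then Conj (fst (snd tr)) (exb k2 k2 (Conj (fst (snd (snd (snd tr))))
      (inst [k2..<k2 + k2] (lookup F (snd (snd (snd (snd tr))))))))
    else Fls) (d_trans d))"

text \<open>The dynamics formula orders its coordinates as \<open>x\<close>, \<open>t\<close>,
  \<open>y\<close>. Here \<open>y\<close> stays free at the variables from \<open>0\<close> and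
  \<open>(x, t)\<close> is quantified behind it, hence the rotated instantiation.\<close>

definition alive_fms :: "game_desc \<Rightarrow> (nat \<times> fm) list" where
  "alive_fms d = map (\<lambda>p. (fst p, exb k2 (Suc k1) (inst ([k2..<k2 + Suc k1] @ [0..<k2]) (snd p)))) (d_locs d)"

definition forces_fm :: "game_desc \<Rightarrow> (nat \<times> fm) list \<Rightarrow> nat \<Rightarrow> fm" where
  "forces_fm d F q = disjs (map (\<lambda>a.
    Conj (succ_fm d (alive_fms d) q a) (Neg (succ_fm d (neg_fms F) q a))) (d_ctrl d))"

definition unsafe_fm :: "game_desc \<Rightarrow> (nat \<times> fm) list \<Rightarrow> nat \<Rightarrow> fm" where
  "unsafe_fm d F q = disjs (map (succ_fm d (neg_fms F) q) (d_unctrl d))"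

text \<open>In \<open>at_fm\<close> and \<open>good_fm\<close> the variables below \<open>k1\<close> hold \<open>x\<close>, variable \<open>k1\<close> the current time,
  \<open>k1 + 1\<close> the time of the controllable move and \<open>k1 + 2\<close> that of the interrupting one.\<close>

definition at_fm :: "fm \<Rightarrow> fm \<Rightarrow> nat \<Rightarrow> fm" where
  "at_fm \<Gamma> \<phi> v = exb (k1 + 3) k2
    (Conj (inst ([0..<k1] @ v # [k1 + 3..<k1 + 3 + k2]) \<Gamma>) (inst [k1 + 3..<k1 + 3 + k2] \<phi>))"

definition good_fm :: "fm \<Rightarrow> fm \<Rightarrow> fm \<Rightarrow> fm" where
  "good_fm \<Gamma> \<phi> \<psi> = Ex (k1 + 1) (Conj (Neg (Less (Var (k1 + 1)) (Var k1)))
    (Conj (at_fm \<Gamma> \<phi> (k1 + 1))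
      (Neg (Ex (k1 + 2) (Conj (Neg (Less (Var (k1 + 2)) (Var k1)))
        (Conj (Neg (Less (Var (k1 + 1)) (Var (k1 + 2)))) (at_fm \<Gamma> \<psi> (k1 + 2))))))))"

text \<open>Goal membership depends on the location alone and is settled while the formula is built.
  The conjunct \<open>\<chi>\<close> is essential: tuples outside \<open>V2\<close> lie on no
  trajectory and would satisfy the universal condition vacuously.\<close>

definition cpre_fms :: "fm \<Rightarrow> game_desc \<Rightarrow> (nat \<times> fm) list \<Rightarrow> (nat \<times> fm) list" where
  "cpre_fms \<chi> d F = map (\<lambda>p. (fst p, Conj \<chi> (if fst p \<in> set (d_goal d) then Neg Fls
    else Neg (exb k2 (Suc k1) (Conj (inst ([k2..<k2 + Suc k1] @ [0..<k2]) (snd p))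
      (Neg (inst [k2..<k2 + Suc k1] (good_fm (snd p) (forces_fm d F (fst p)) (unsafe_fm d F (fst p)))))))))) (d_locs d)"

definition attr_fms :: "fm \<Rightarrow> game_desc \<Rightarrow> nat \<Rightarrow> (nat \<times> fm) list" where
  "attr_fms \<chi> d n = (cpre_fms \<chi> d ^^ n) (map (\<lambda>p. (fst p, Fls)) (d_locs d))"

definition grows_fm :: "fm \<Rightarrow> game_desc \<Rightarrow> nat \<Rightarrow> fm" where
  "grows_fm \<chi> d n = disjs (map (\<lambda>p. exb 0 k2
    (Conj (lookup (attr_fms \<chi> d (Suc n)) (fst p)) (Neg (lookup (attr_fms \<chi> d n) (fst p))))) (d_locs d))"

end

text \<open>The formula for \<open>V2\<close> will be read off from slices of pieces at a location,
  so it is available only if there is one.\<close>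

locale described_game =
  fixes M :: "'m::ordered_grp fo_struct" and k1 k2 :: nat
    and V1 :: "'m list set" and V :: "'m set" and V2 :: "'m list set"
    and A :: "'m game" and d :: game_desc and \<chi> :: fm
  assumes len1: "x \<in> V1 \<Longrightarrow> length x = k1" and len2: "y \<in> V2 \<Longrightarrow> length y = k2"
    and game: "is_game M k1 k2 V1 V V2 A"
    and desc: "describes M k1 k2 V1 V V2 d A"
    and V2_fm: "locs A \<noteq> {} \<Longrightarrow> fm_defines M \<chi> k2 V2"
begin

section \<open>Correctness of the formulas for a described game\<close>

lemma transition_closed:
  assumes "(q, g, a, R, q') \<in> transitions A"
  shows "q \<in> locs A" and "q' \<in> locs A" and "g \<subseteq> V2" and "\<forall>y\<in>V2. R y \<subseteq> V2"
proof -
  have "\<forall>(q, g, a, R, q')\<in>transitions A. q \<in> locs A \<and> a \<in> actions A \<and> q' \<in> locs A \<and> g \<subseteq> V2 \<and>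
      definable M k2 g \<and> (\<forall>y\<in>V2. R y \<subseteq> V2) \<and> definable M (k2 + k2) (reset_graph V2 R)"
    using game unfolding is_game_def by (elim conjE) assumption
  from bspec[OF this assms] show "q \<in> locs A" "q' \<in> locs A" "g \<subseteq> V2" "\<forall>y\<in>V2. R y \<subseteq> V2"
    by simp_all
qed

sublocale game_arena V1 V V2 A
proof
  fix s a s' assume "disc_step A s a s'"
  then obtain q g R q' y y' where s: "s = (q, y)" "s' = (q', y')"
    and tr: "(q, g, a, R, q') \<in> transitions A" "y \<in> g" "y' \<in> R y"
    unfolding disc_step_def by (cases s; cases s') auto
  show "s \<in> locs A \<times> V2 \<and> s' \<in> locs A \<times> V2"
    using transition_closed[OF tr(1)] tr(2,3) s by blast
next
  show "dyn A q x t \<in> V2" if "q \<in> locs A" "x \<in> V1" "t \<in> V" for q x t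
    using game that unfolding is_game_def by blast
qed

lemma locs_eq: "fst ` set (d_locs d) = locs A"
  using desc by (simp add: describes_def)

lemma dyn_fm:
  assumes "p \<in> set (d_locs d)"
  shows "fm_defines M (snd p) (k1 + 1 + k2) (dyn_graph V1 V (dyn A (fst p)))"
proof -
  have "\<forall>(q, \<phi>)\<in>set (d_locs d). fm_defines M \<phi> (k1 + 1 + k2) (dyn_graph V1 V (dyn A q))"
    using desc unfolding describes_def by (elim conjE) assumption
  from bspec[OF this assms] show ?thesis by (simp add: case_prod_beta)
qed

text \<open>Graphs are stored as plain concatenations; the fixed length of the tuples in
  \<open>V1\<close> makes the splitting unique.\<close>

lemma mem_dyn_graph:
  assumes "length x = k1"
  shows "x @ t # y \<in> dyn_graph V1 V f \<longleftrightarrow> x \<in> V1 \<and> t \<in> V \<and> y = f x t"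
proof
  assume "x @ t # y \<in> dyn_graph V1 V f"
  then obtain x' t' where "x @ t # y = x' @ t' # f x' t'" "x' \<in> V1" "t' \<in> V"
    unfolding dyn_graph_def by blast
  then show "x \<in> V1 \<and> t \<in> V \<and> y = f x t" using assms len1[of x'] by simp
qed (auto simp: dyn_graph_def)

lemma mem_reset_graph:
  assumes "length y = k2"
  shows "y @ z \<in> reset_graph V2 R \<longleftrightarrow> y \<in> V2 \<and> z \<in> R y"
proof
  assume "y @ z \<in> reset_graph V2 R"
  then obtain y' z' where "y @ z = y' @ z'" "y' \<in> V2" "z' \<in> R y'"
    unfolding reset_graph_def by blast
  then show "y \<in> V2 \<and> z \<in> R y" using assms len2[of y'] by simp
qed (auto simp: reset_graph_def)

definition represents :: "(nat \<times> fm) list \<Rightarrow> (nat \<times> 'm list) set \<Rightarrow> bool" where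
  "represents F S \<longleftrightarrow> fst ` set F = locs A \<and> (\<forall>p\<in>set F. fm_defines M (snd p) k2 {y. (fst p, y) \<in> S})"

lemma sat_lookup: "sat M e (lookup F q) \<longleftrightarrow> (\<exists>p\<in>set F. fst p = q \<and> sat M e (snd p))"
  unfolding lookup_def sat_disjs set_map bex_simps by (rule bex_cong) simp_all

lemma lookup_defines:
  assumes "represents F S" and "q \<in> locs A"
  shows "fm_defines M (lookup F q) k2 {y. (q, y) \<in> S}"
proof (rule fm_definesI)
  have F: "fm_defines M (snd p) k2 {y. (fst p, y) \<in> S}" if "p \<in> set F" for p
    using assms(1) that by (simp add: represents_def)
  obtain p where p: "p \<in> set F" "fst p = q" using assms unfolding represents_def by (metis imageE)
  show "wf_fm M (lookup F q)" using fm_definesD(1)[OF F] by (auto simp: lookup_def)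
  show "fv_fm (lookup F q) \<subseteq> {..<k2}"
    using fm_definesD(2)[OF F] by (fastforce simp: lookup_def split: if_splits)
  show "length y = k2" if "y \<in> {y. (q, y) \<in> S}" for y
    using fm_definesD(3)[OF F[OF p(1)]] p(2) that by blast
  show "sat M ((!) y) (lookup F q) \<longleftrightarrow> y \<in> {y. (q, y) \<in> S}" if y: "length y = k2" for y
  proof -
    have "sat M ((!) y) (snd p) \<longleftrightarrow> (fst p, y) \<in> S" if "p \<in> set F" for p
      using sat_defines[OF F[OF that], of "(!) y"] map_nth[of y] y by simp
    then show ?thesis using p unfolding sat_lookup by auto
  qed
qed

lemma succ_fm_defines:
  assumes F: "represents F S"
  shows "fm_defines M (succ_fm k2 d F q a) k2 {y. \<exists>s'. disc_step A (q, y) a s' \<and> s' \<in> S}"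
proof (rule fm_definesI)
  have rel: "rel_set (describes_trans M k2 V2) (set (d_trans d)) (transitions A)"
    using desc by (simp add: describes_def)
  have tr: "\<exists>g R. (q, g, a, R, q') \<in> transitions A \<and> fm_defines M \<phi> k2 g \<and>
      fm_defines M \<psi> (k2 + k2) (reset_graph V2 R) \<and> q' \<in> locs A"
    if t0: "(q, \<phi>, a, \<psi>, q') \<in> set (d_trans d)" for q \<phi> a \<psi> q'
  proof -
    obtain t where "t \<in> transitions A" "describes_trans M k2 V2 (q, \<phi>, a, \<psi>, q') t"
      using rel_setD1[OF rel t0] by blast
    then obtain g R where "(q, g, a, R, q') \<in> transitions A" "fm_defines M \<phi> k2 g"
      "fm_defines M \<psi> (k2 + k2) (reset_graph V2 R)"
      by (cases t) (auto simp: describes_trans_def)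
    then show ?thesis using transition_closed(2) by blast
  qed
  have sub: "wf_fm M \<phi>" "fv_fm \<phi> \<subseteq> {..<k2}" "wf_fm M \<psi>" "fv_fm \<psi> \<subseteq> {..<k2 + k2}"
      "wf_fm M (lookup F q')" "fv_fm (inst [k2..<k2 + k2] (lookup F q')) \<subseteq> {k2..<k2 + k2}"
    if t: "(q, \<phi>, a, \<psi>, q') \<in> set (d_trans d)" for q \<phi> a \<psi> q'
    using tr[OF t] lookup_defines[OF F, of q'] fv_inst_defines[OF lookup_defines[OF F, of q'], of "[k2..<k2 + k2]"]
    by (auto dest: fm_definesD(1,2))
  show "wf_fm M (succ_fm k2 d F q a)"
    using sub by (auto simp: succ_fm_def)
  show "fv_fm (succ_fm k2 d F q a) \<subseteq> {..<k2}"
  proof -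
    have fv: "fv_fm \<phi> \<union> (fv_fm \<psi> \<union> fv_fm (inst [k2..<k2 + k2] (lookup F q')) - {k2..<k2 + k2}) \<subseteq> {..<k2}"
      if "(q, \<phi>, a, \<psi>, q') \<in> set (d_trans d)" for \<phi> \<psi> q'
      using sub(2,4,6)[OF that] by fastforce
    show ?thesis
    proof
      fix v assume "v \<in> fv_fm (succ_fm k2 d F q a)"
      then obtain tr where tr: "tr \<in> set (d_trans d)" "fst tr = q" "fst (snd (snd tr)) = a"
        "v \<in> fv_fm (fst (snd tr)) \<union> (fv_fm (fst (snd (snd (snd tr)))) \<union>
          fv_fm (inst [k2..<k2 + k2] (lookup F (snd (snd (snd (snd tr)))))) - {k2..<k2 + k2})"
        unfolding succ_fm_def fv_disjs set_map UN_simps by (auto simp del: lessThan_iff split: if_splits)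
      obtain \<phi> \<psi> q' where "tr = (q, \<phi>, a, \<psi>, q')" using tr(2,3) by (metis prod.collapse)
      then show "v \<in> {..<k2}" using fv[of \<phi> \<psi> q'] tr(1,4) by auto
    qed
  qed
  show "length y = k2" if "y \<in> {y. \<exists>s'. disc_step A (q, y) a s' \<and> s' \<in> S}" for y
    using that disc_step_closed len2 by blast
  fix y :: "'m list" assume y: "length y = k2"
  have body: "sat M ((!) y) (Conj \<phi> (exb k2 k2 (Conj \<psi> (inst [k2..<k2 + k2] (lookup F q'))))) \<longleftrightarrow>
      y \<in> g \<and> (\<exists>z. y \<in> V2 \<and> z \<in> R y \<and> (q', z) \<in> S)"
    if t: "(q, \<phi>, a, \<psi>, q') \<in> set (d_trans d)" and g: "fm_defines M \<phi> k2 g"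
      and R: "fm_defines M \<psi> (k2 + k2) (reset_graph V2 R)" and RV2: "\<forall>y\<in>V2. R y \<subseteq> V2" for \<phi> \<psi> q' g R
  proof -
    have q': "q' \<in> locs A" using tr[OF t] by blast
    have "sat M ((!) y) \<phi> \<longleftrightarrow> y \<in> g" using sat_defines[OF g, of "(!) y"] map_nth[of y] y by simp
    moreover have "sat M (upd ((!) y) k2 z) \<psi> \<longleftrightarrow> y \<in> V2 \<and> z \<in> R y" if z: "length z = k2" for z
    proof -
      have "map (upd ((!) y) k2 z) [0..<k2 + k2] = y @ z"
        using map_upd[OF z, of "(!) y" k2] map_upd_disjoint[of k2 k2 z 0 "(!) y"] map_nth[of y] y
        by (metis le0 map_append order_refl upt_add_eq_append)
      then show ?thesis using sat_defines[OF R] mem_reset_graph[OF y] by simp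
    qed
    moreover have "sat M (upd ((!) y) k2 z) (inst [k2..<k2 + k2] (lookup F q')) \<longleftrightarrow> (q', z) \<in> S"
      if z: "length z = k2" for z
      using sat_inst_defines[OF lookup_defines[OF F q']] map_upd[OF z] by simp
    \<comment> \<open>The quantifier block ranges over tuples of length \<open>k2\<close> only;
      reset values on \<open>V2\<close> have that length, so no successor is lost.\<close>
    moreover have "length z = k2" if "y \<in> V2" "z \<in> R y" for z using that len2 RV2 by blast
    ultimately show ?thesis unfolding sat.simps sat_exb by blast
  qed
  show "sat M ((!) y) (succ_fm k2 d F q a) \<longleftrightarrow> y \<in> {y. \<exists>s'. disc_step A (q, y) a s' \<and> s' \<in> S}"
  proof
    assume "sat M ((!) y) (succ_fm k2 d F q a)"
    then obtain tr where tr': "tr \<in> set (d_trans d)" and h: "sat M ((!) y)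
        (if fst tr = q \<and> fst (snd (snd tr)) = a
         then Conj (fst (snd tr)) (exb k2 k2 (Conj (fst (snd (snd (snd tr))))
           (inst [k2..<k2 + k2] (lookup F (snd (snd (snd (snd tr))))))))
         else Fls)"
      unfolding succ_fm_def sat_disjs set_map bex_simps by (elim bexE)
    have c: "fst tr = q \<and> fst (snd (snd tr)) = a"
    proof (rule ccontr)
      assume "\<not> (fst tr = q \<and> fst (snd (snd tr)) = a)"
      then show False using h by (simp only: if_False sat_Fls)
    qed
    obtain \<phi> \<psi> q' where tr_eq: "tr = (q, \<phi>, a, \<psi>, q')" using c by (metis prod.collapse)
    have t: "(q, \<phi>, a, \<psi>, q') \<in> set (d_trans d)" using tr' by (simp only: tr_eq)
    have s: "sat M ((!) y) (Conj \<phi> (exb k2 k2 (Conj \<psi> (inst [k2..<k2 + k2] (lookup F q')))))"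
      using h unfolding tr_eq by (simp only: fst_conv snd_conv simp_thms if_True)
    obtain g R where gR: "(q, g, a, R, q') \<in> transitions A" "fm_defines M \<phi> k2 g"
      "fm_defines M \<psi> (k2 + k2) (reset_graph V2 R)" using tr[OF t] by blast
    obtain z where "y \<in> g" "z \<in> R y" "(q', z) \<in> S"
      using body[OF t gR(2,3) transition_closed(4)[OF gR(1)]] s by blast
    then have "disc_step A (q, y) a (q', z)" using gR(1) by (auto simp: disc_step_def)
    then show "y \<in> {y. \<exists>s'. disc_step A (q, y) a s' \<and> s' \<in> S}" using \<open>(q', z) \<in> S\<close> by blast
  next
    assume "y \<in> {y. \<exists>s'. disc_step A (q, y) a s' \<and> s' \<in> S}"
    then obtain q' z g R where gR: "(q, g, a, R, q') \<in> transitions A" "y \<in> g" "z \<in> R y" "(q', z) \<in> S"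
      by (auto simp: disc_step_def)
    have V2: "\<forall>y\<in>V2. R y \<subseteq> V2" "y \<in> V2" using transition_closed[OF gR(1)] gR(2) by blast+
    obtain \<phi> \<psi> where t: "(q, \<phi>, a, \<psi>, q') \<in> set (d_trans d)"
      and "fm_defines M \<phi> k2 g" "fm_defines M \<psi> (k2 + k2) (reset_graph V2 R)"
      using rel_setD2[OF rel gR(1)] by (auto simp: describes_trans_def)
    then have s: "sat M ((!) y) (Conj \<phi> (exb k2 k2 (Conj \<psi> (inst [k2..<k2 + k2] (lookup F q')))))"
      using body[OF t _ _ V2(1)] gR V2(2) by blast
    show "sat M ((!) y) (succ_fm k2 d F q a)"
      unfolding succ_fm_def sat_disjs set_map bex_simps
      by (rule bexI[OF _ t]) (use s in simp)
  qed
qed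

text \<open>Negation complements within all tuples of length \<open>k2\<close>, possibly beyond
  \<open>V2\<close>. The difference never shows, because successors lie in
  \<open>V2\<close>.\<close>

lemma represents_neg:
  assumes "represents F S"
  shows "represents (neg_fms F) {s. length (snd s) = k2 \<and> s \<notin> S}"
proof -
  have "fm_defines M (Neg (snd p)) k2 {y. length y = k2 \<and> (fst p, y) \<notin> S}" if "p \<in> set F" for p
  proof -
    have *: "fm_defines M (snd p) k2 {y. (fst p, y) \<in> S}"
      using assms that by (simp add: represents_def)
    have "(fst p, y) \<in> S \<longleftrightarrow> length y = k2 \<and> sat M ((!) y) (snd p)" for y
      using fm_definesD(3)[OF *] by blast
    then show ?thesis using * by (auto simp: fm_defines_def)
  qed
  then show ?thesis using assms by (auto simp: represents_def neg_fms_def image_image)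
qed

lemma sat_dyn_pre:
  assumes "p \<in> set (d_locs d)" and "length y = k2" and "length xt = Suc k1"
  shows "sat M (upd ((!) y) k2 xt) (inst ([k2..<k2 + Suc k1] @ [0..<k2]) (snd p)) \<longleftrightarrow>
    take k1 xt \<in> V1 \<and> xt ! k1 \<in> V \<and> y = dyn A (fst p) (take k1 xt) (xt ! k1)"
proof -
  have xt: "xt = take k1 xt @ [xt ! k1]"
    using assms(3) by (metis lessI order_refl take_Suc_conv_app_nth take_all)
  have "map (upd ((!) y) k2 xt) ([k2..<k2 + Suc k1] @ [0..<k2]) = xt @ y"
    using map_upd[OF assms(3), of "(!) y" k2] map_upd_disjoint[of k2 k2 xt 0 "(!) y"] map_nth[of y] assms(2)
    by (metis map_append order_refl)
  also have "\<dots> = take k1 xt @ xt ! k1 # y" by (subst xt) simp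
  finally show ?thesis
    using sat_inst_defines[OF dyn_fm[OF assms(1)], of "[k2..<k2 + Suc k1] @ [0..<k2]"]
      mem_dyn_graph[of "take k1 xt"] assms(3) by simp
qed

lemma represents_alive: "represents (alive_fms k1 k2 d) {s \<in> locs A \<times> V2. alive s}"
proof -
  have "fm_defines M (exb k2 (Suc k1) (inst ([k2..<k2 + Suc k1] @ [0..<k2]) (snd p))) k2
      {y. (fst p, y) \<in> locs A \<times> V2 \<and> alive (fst p, y)}" if p: "p \<in> set (d_locs d)" for p
  proof (rule fm_definesI)
    have q: "fst p \<in> locs A" using p locs_eq by blast
    let ?vs = "[k2..<k2 + Suc k1] @ [0..<k2]"
    show "wf_fm M (exb k2 (Suc k1) (inst ?vs (snd p)))"
      using fm_definesD(1)[OF dyn_fm[OF p]] by simp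
    show "fv_fm (exb k2 (Suc k1) (inst ?vs (snd p))) \<subseteq> {..<k2}"
      using fv_inst_defines[OF dyn_fm[OF p], of ?vs] by auto
    show "length y = k2" if "y \<in> {y. (fst p, y) \<in> locs A \<times> V2 \<and> alive (fst p, y)}" for y
      using that len2 by blast
    fix y :: "'m list" assume y: "length y = k2"
    have "(\<exists>xt. length xt = Suc k1 \<and> take k1 xt \<in> V1 \<and> xt ! k1 \<in> V \<and> y = dyn A (fst p) (take k1 xt) (xt ! k1)) \<longleftrightarrow>
        (\<exists>x\<in>V1. \<exists>t\<in>V. dyn A (fst p) x t = y)" (is "?L \<longleftrightarrow> ?R")
    proof
      assume ?R
      then obtain x t where "x \<in> V1" "t \<in> V" "dyn A (fst p) x t = y" by blast
      then show ?L using len1[of x] by (intro exI[of _ "x @ [t]"]) auto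
    qed blast
    then show "sat M ((!) y) (exb k2 (Suc k1) (inst ?vs (snd p))) \<longleftrightarrow>
        y \<in> {y. (fst p, y) \<in> locs A \<times> V2 \<and> alive (fst p, y)}"
      using sat_dyn_pre[OF p y] dyn_closed[OF q] q unfolding sat_exb alive_def by auto
  qed
  then show ?thesis using locs_eq by (auto simp: represents_def alive_fms_def image_image simp del: exb.simps)
qed

lemma forces_fm_defines:
  assumes "represents F W"
  shows "fm_defines M (forces_fm k1 k2 d F q) k2 {y. \<exists>a\<in>ctrl A. forces W a (q, y)}"
proof -
  note 1 = succ_fm_defines[OF represents_alive]
  note 2 = succ_fm_defines[OF represents_neg[OF assms]]
  have ctrl: "set (d_ctrl d) = ctrl A" using desc by (simp add: describes_def)
  have f: "forces W a (q, y) \<longleftrightarrow> (\<exists>s'. disc_step A (q, y) a s' \<and> s' \<in> {s \<in> locs A \<times> V2. alive s}) \<and>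
      \<not> (\<exists>s'. disc_step A (q, y) a s' \<and> s' \<in> {s. length (snd s) = k2 \<and> s \<notin> W})" for a y
  proof -
    have "s' \<in> locs A \<times> V2 \<and> length (snd s') = k2" if "disc_step A (q, y) a s'" for s'
      using disc_step_closed[OF that] len2 by auto
    then show ?thesis unfolding forces_def by blast
  qed
  show ?thesis
  proof (rule fm_definesI)
    show "wf_fm M (forces_fm k1 k2 d F q)" "fv_fm (forces_fm k1 k2 d F q) \<subseteq> {..<k2}"
      using fm_definesD(1,2)[OF 1] fm_definesD(1,2)[OF 2] by (fastforce simp: forces_fm_def)+
    show "length y = k2" if "y \<in> {y. \<exists>a\<in>ctrl A. forces W a (q, y)}" for y
      using that disc_step_closed len2 unfolding forces_def by blast
    fix y :: "'m list" assume "length y = k2"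
    then have "map ((!) y) [0..<k2] = y" using map_nth[of y] by simp
    then show "sat M ((!) y) (forces_fm k1 k2 d F q) \<longleftrightarrow> y \<in> {y. \<exists>a\<in>ctrl A. forces W a (q, y)}"
      unfolding forces_fm_def by (simp add: ctrl f sat_defines[OF 1] sat_defines[OF 2])
  qed
qed

lemma unsafe_fm_defines:
  assumes "represents F W"
  shows "fm_defines M (unsafe_fm k2 d F q) k2 {y. \<not> safe W (q, y)}"
proof -
  note 2 = succ_fm_defines[OF represents_neg[OF assms]]
  have unctrl: "set (d_unctrl d) = unctrl A" using desc by (simp add: describes_def)
  have f: "safe W (q, y) \<longleftrightarrow> (\<forall>u\<in>unctrl A.
      \<not> (\<exists>s'. disc_step A (q, y) u s' \<and> s' \<in> {s. length (snd s) = k2 \<and> s \<notin> W}))" for y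
  proof -
    have "length (snd s') = k2" if "disc_step A (q, y) u s'" for u s'
      using disc_step_closed[OF that] len2 by auto
    then show ?thesis unfolding safe_def by blast
  qed
  show ?thesis
  proof (rule fm_definesI)
    show "wf_fm M (unsafe_fm k2 d F q)" "fv_fm (unsafe_fm k2 d F q) \<subseteq> {..<k2}"
      using fm_definesD(1,2)[OF 2] by (fastforce simp: unsafe_fm_def)+
    show "length y = k2" if "y \<in> {y. \<not> safe W (q, y)}" for y
      using that disc_step_closed len2 unfolding safe_def by blast
    fix y :: "'m list" assume "length y = k2"
    then have "map ((!) y) [0..<k2] = y" using map_nth[of y] by simp
    then show "sat M ((!) y) (unsafe_fm k2 d F q) \<longleftrightarrow> y \<in> {y. \<not> safe W (q, y)}"
      unfolding unsafe_fm_def by (simp add: unctrl f sat_defines[OF 2]) blast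
  qed
qed

text \<open>The dynamics is a function, so the quantified point can only be its value at the time
  held by \<open>v\<close>. The bound on \<open>v\<close> keeps that variable clear of the
  quantified block.\<close>

lemma sat_at_fm:
  assumes p: "p \<in> set (d_locs d)" and \<phi>: "fm_defines M \<phi> k2 S" and v: "v < k1 + 3"
    and x: "map e [0..<k1] \<in> V1"
  shows "sat M e (at_fm k1 k2 (snd p) \<phi> v) \<longleftrightarrow> e v \<in> V \<and> dyn A (fst p) (map e [0..<k1]) (e v) \<in> S"
proof -
  let ?Y = "[k1 + 3..<k1 + 3 + k2]"
  have q: "fst p \<in> locs A" using p locs_eq by blast
  have "sat M (upd e (k1 + 3) y) (inst ([0..<k1] @ v # ?Y) (snd p)) \<longleftrightarrow>
      e v \<in> V \<and> y = dyn A (fst p) (map e [0..<k1]) (e v)" if y: "length y = k2" for y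
  proof -
    have m: "map (upd e (k1 + 3) y) ([0..<k1] @ v # ?Y) = map e [0..<k1] @ e v # y"
      using map_upd[OF y, of e "k1 + 3"] map_upd_disjoint[of k1 "k1 + 3" y 0 e] v by (simp add: upd_def)
    have "sat M (upd e (k1 + 3) y) (inst ([0..<k1] @ v # ?Y) (snd p)) \<longleftrightarrow>
        map (upd e (k1 + 3) y) ([0..<k1] @ v # ?Y) \<in> dyn_graph V1 V (dyn A (fst p))"
      by (rule sat_inst_defines[OF dyn_fm[OF p]]) simp
    then show ?thesis unfolding m using mem_dyn_graph[of "map e [0..<k1]"] x by simp
  qed
  moreover have "sat M (upd e (k1 + 3) y) (inst ?Y \<phi>) \<longleftrightarrow> y \<in> S" if "length y = k2" for y
    using sat_inst_defines[OF \<phi>, of ?Y] map_upd[OF that, of e "k1 + 3"] by simp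
  moreover have "length (dyn A (fst p) (map e [0..<k1]) (e v)) = k2" if "e v \<in> V"
    using dyn_closed[OF q x that] len2 by blast
  ultimately show ?thesis unfolding at_fm_def by auto
qed

lemma fv_at_fm:
  assumes p: "p \<in> set (d_locs d)" and \<phi>: "fm_defines M \<phi> k2 S"
  shows "fv_fm (at_fm k1 k2 (snd p) \<phi> v) \<subseteq> insert v {..<k1}"
proof -
  let ?Y = "{k1 + 3..<k1 + 3 + k2}"
  have *: "(F1 \<union> F2) - B \<subseteq> insert v A" if "F1 \<subseteq> A \<union> insert v B" "F2 \<subseteq> B" for F1 F2 A B :: "nat set"
    using that by blast
  show ?thesis
    unfolding at_fm_def fv_exb fv_fm.simps
  proof (rule *)
    show "fv_fm (inst ([0..<k1] @ v # [k1 + 3..<k1 + 3 + k2]) (snd p)) \<subseteq> {..<k1} \<union> insert v ?Y"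
      using fv_inst_defines[OF dyn_fm[OF p], of "[0..<k1] @ v # [k1 + 3..<k1 + 3 + k2]"]
      by (simp add: atLeast0LessThan)
    show "fv_fm (inst [k1 + 3..<k1 + 3 + k2] \<phi>) \<subseteq> ?Y"
      using fv_inst_defines[OF \<phi>, of "[k1 + 3..<k1 + 3 + k2]"] by simp
  qed
qed

lemma wf_at_fm:
  assumes p: "p \<in> set (d_locs d)" and \<phi>: "fm_defines M \<phi> k2 S"
  shows "wf_fm M (at_fm k1 k2 (snd p) \<phi> v)"
  using fm_definesD(1)[OF dyn_fm[OF p]] fm_definesD(1)[OF \<phi>] by (simp add: at_fm_def)

lemma good_fm_correct:
  assumes p: "p \<in> set (d_locs d)" and F: "represents F W"
  defines "\<gamma> \<equiv> good_fm k1 k2 (snd p) (forces_fm k1 k2 d F (fst p)) (unsafe_fm k2 d F (fst p))"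
  shows "wf_fm M \<gamma>" and "fv_fm \<gamma> \<subseteq> {..<Suc k1}"
    and "map e [0..<k1] \<in> V1 \<Longrightarrow> sat M e \<gamma> \<longleftrightarrow> (\<exists>t'. good_time W (fst p) (map e [0..<k1]) (e k1) t')"
proof -
  note 1 = forces_fm_defines[OF F, of "fst p"] and 2 = unsafe_fm_defines[OF F, of "fst p"]
  show "wf_fm M \<gamma>" using wf_at_fm[OF p 1] wf_at_fm[OF p 2] by (simp add: \<gamma>_def good_fm_def)
  show "fv_fm \<gamma> \<subseteq> {..<Suc k1}"
    using fv_at_fm[OF p 1, of "k1 + 1"] fv_at_fm[OF p 2, of "k1 + 2"]
    unfolding \<gamma>_def good_fm_def by fastforce
  assume x: "map e [0..<k1] \<in> V1"
  have [simp]: "map (e(k1 + 1 := t)) [0..<k1] = map e [0..<k1]"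
    "map (e(k1 + 1 := t, k1 + 2 := t')) [0..<k1] = map e [0..<k1]" for t t'
    by auto
  have "sat M (e(k1 + 1 := t')) (at_fm k1 k2 (snd p) (forces_fm k1 k2 d F (fst p)) (k1 + 1)) \<longleftrightarrow>
      t' \<in> V \<and> (\<exists>a\<in>ctrl A. forces W a (fst p, dyn A (fst p) (map e [0..<k1]) t'))" for t'
    using sat_at_fm[OF p 1, of "k1 + 1" "e(k1 + 1 := t')"] x by simp
  moreover have "sat M (e(k1 + 1 := t', k1 + 2 := t'')) (at_fm k1 k2 (snd p) (unsafe_fm k2 d F (fst p)) (k1 + 2)) \<longleftrightarrow>
      t'' \<in> V \<and> \<not> safe W (fst p, dyn A (fst p) (map e [0..<k1]) t'')" for t' t''
    using sat_at_fm[OF p 2, of "k1 + 2" "e(k1 + 1 := t', k1 + 2 := t'')"] x by simp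
  ultimately show "sat M e \<gamma> \<longleftrightarrow> (\<exists>t'. good_time W (fst p) (map e [0..<k1]) (e k1) t')"
    unfolding \<gamma>_def good_fm_def good_time_def sat.simps val.simps fun_upd_apply
    by (intro ex_cong1) (auto simp: not_less)
qed

lemma represents_cpre:
  assumes F: "represents F W"
  shows "represents (cpre_fms k1 k2 \<chi> d F) (cpre W)"
proof -
  have goal: "set (d_goal d) = goal A" using desc by (simp add: describes_def)
  have "fm_defines M (Conj \<chi> (if fst p \<in> set (d_goal d) then Neg Fls
    else Neg (exb k2 (Suc k1) (Conj (inst ([k2..<k2 + Suc k1] @ [0..<k2]) (snd p))
      (Neg (inst [k2..<k2 + Suc k1] (good_fm k1 k2 (snd p) (forces_fm k1 k2 d F (fst p)) (unsafe_fm k2 d F (fst p)))))))))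
    k2 {y. (fst p, y) \<in> cpre W}" (is "fm_defines M (Conj \<chi> ?\<psi>) _ _") if p: "p \<in> set (d_locs d)" for p
  proof (rule fm_definesI)
    let ?\<gamma> = "good_fm k1 k2 (snd p) (forces_fm k1 k2 d F (fst p)) (unsafe_fm k2 d F (fst p))"
    let ?vs = "[k2..<k2 + Suc k1] @ [0..<k2]"
    note \<gamma> = good_fm_correct[OF p F]
    have q: "fst p \<in> locs A" using p locs_eq by blast
    then have \<chi>: "fm_defines M \<chi> k2 V2" using V2_fm by blast
    show "wf_fm M (Conj \<chi> ?\<psi>)"
      using fm_definesD(1)[OF \<chi>] \<gamma>(1) fm_definesD(1)[OF dyn_fm[OF p]] by simp
    have "fv_fm (inst ?vs (snd p)) \<subseteq> set ?vs"
      using fv_inst_defines[OF dyn_fm[OF p], of ?vs] by simp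
    moreover have "fv_fm (inst [k2..<k2 + Suc k1] ?\<gamma>) \<subseteq> set [k2..<k2 + Suc k1]"
      using fv_inst[of ?\<gamma> "[k2..<k2 + Suc k1]"] \<gamma>(2) by simp
    ultimately show "fv_fm (Conj \<chi> ?\<psi>) \<subseteq> {..<k2}"
      using fm_definesD(2)[OF \<chi>] by (auto simp del: exb.simps)
    show "length y = k2" if "y \<in> {y. (fst p, y) \<in> cpre W}" for y
      using that len2 unfolding cpre_def by blast
    fix y :: "'m list" assume y: "length y = k2"
    have "sat M ((!) y) \<chi> \<longleftrightarrow> y \<in> V2" using sat_defines[OF \<chi>, of "(!) y"] map_nth[of y] y by simp
    moreover have "sat M ((!) y) (exb k2 (Suc k1) (Conj (inst ?vs (snd p)) (Neg (inst [k2..<k2 + Suc k1] ?\<gamma>)))) \<longleftrightarrow>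
      (\<exists>x\<in>V1. \<exists>t\<in>V. dyn A (fst p) x t = y \<and> \<not> (\<exists>t'. good_time W (fst p) x t t'))"
    proof -
      have "sat M (upd ((!) y) k2 (x @ [t])) (inst [k2..<k2 + Suc k1] ?\<gamma>) \<longleftrightarrow>
          (\<exists>t'. good_time W (fst p) x t t')" if x: "x \<in> V1" for x t
      proof -
        have "length (x @ [t]) = Suc k1" using len1[OF x] by simp
        then have m: "map (upd ((!) y) k2 (x @ [t])) [k2..<k2 + Suc k1] = x @ [t]" by (rule map_upd)
        have "sat M (upd ((!) y) k2 (x @ [t])) (inst [k2..<k2 + Suc k1] ?\<gamma>) \<longleftrightarrow>
            sat M ((!) (map (upd ((!) y) k2 (x @ [t])) [k2..<k2 + Suc k1])) ?\<gamma>"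
          by (rule sat_inst) (use \<gamma>(2) in simp)
        then have "sat M (upd ((!) y) k2 (x @ [t])) (inst [k2..<k2 + Suc k1] ?\<gamma>) \<longleftrightarrow> sat M ((!) (x @ [t])) ?\<gamma>"
          unfolding m .
        moreover have "map ((!) (x @ [t])) [0..<k1] = x" "(x @ [t]) ! k1 = t"
          using len1[OF x] by (auto simp: nth_append intro: nth_equalityI)
        ultimately show ?thesis using \<gamma>(3)[of "(!) (x @ [t])"] x by simp
      qed
      note good = this
      have "sat M ((!) y) (exb k2 (Suc k1) (Conj (inst ?vs (snd p)) (Neg (inst [k2..<k2 + Suc k1] ?\<gamma>)))) \<longleftrightarrow>
        (\<exists>xt. length xt = Suc k1 \<and> (take k1 xt \<in> V1 \<and> xt ! k1 \<in> V \<and> y = dyn A (fst p) (take k1 xt) (xt ! k1)) \<and>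
          \<not> sat M (upd ((!) y) k2 xt) (inst [k2..<k2 + Suc k1] ?\<gamma>))"
        unfolding sat_exb sat.simps using sat_dyn_pre[OF p y] by blast
      also have "\<dots> \<longleftrightarrow> (\<exists>x\<in>V1. \<exists>t\<in>V. dyn A (fst p) x t = y \<and> \<not> (\<exists>t'. good_time W (fst p) x t t'))"
      proof
        assume "\<exists>xt. length xt = Suc k1 \<and> (take k1 xt \<in> V1 \<and> xt ! k1 \<in> V \<and> y = dyn A (fst p) (take k1 xt) (xt ! k1)) \<and>
          \<not> sat M (upd ((!) y) k2 xt) (inst [k2..<k2 + Suc k1] ?\<gamma>)"
        then obtain xt where l: "length xt = Suc k1" and
          xt: "take k1 xt \<in> V1" "xt ! k1 \<in> V" "y = dyn A (fst p) (take k1 xt) (xt ! k1)"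
          "\<not> sat M (upd ((!) y) k2 xt) (inst [k2..<k2 + Suc k1] ?\<gamma>)" by blast
        have "take k1 xt @ [xt ! k1] = xt"
          using l by (metis lessI order_refl take_Suc_conv_app_nth take_all)
        then have "\<not> (\<exists>t'. good_time W (fst p) (take k1 xt) (xt ! k1) t')"
          using good[OF xt(1), of "xt ! k1"] xt(4) by simp
        then show "\<exists>x\<in>V1. \<exists>t\<in>V. dyn A (fst p) x t = y \<and> \<not> (\<exists>t'. good_time W (fst p) x t t')"
          using xt by blast
      next
        assume "\<exists>x\<in>V1. \<exists>t\<in>V. dyn A (fst p) x t = y \<and> \<not> (\<exists>t'. good_time W (fst p) x t t')"
        then obtain x t where xt: "x \<in> V1" "t \<in> V" "dyn A (fst p) x t = y"
          "\<not> (\<exists>t'. good_time W (fst p) x t t')" by blast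
        then show "\<exists>xt. length xt = Suc k1 \<and> (take k1 xt \<in> V1 \<and> xt ! k1 \<in> V \<and> y = dyn A (fst p) (take k1 xt) (xt ! k1)) \<and>
          \<not> sat M (upd ((!) y) k2 xt) (inst [k2..<k2 + Suc k1] ?\<gamma>)"
          using good[OF xt(1), of t] len1[OF xt(1)]
          by (intro exI[of _ "x @ [t]"]) (simp add: nth_append)
      qed
      finally show ?thesis .
    qed
    ultimately show "sat M ((!) y) (Conj \<chi> ?\<psi>) \<longleftrightarrow> y \<in> {y. (fst p, y) \<in> cpre W}"
      using q unfolding cpre_def goal by (auto simp del: exb.simps sat_exb)
  qed
  then show ?thesis
    using locs_eq by (auto simp: represents_def cpre_fms_def image_image simp del: exb.simps)
qed

lemma represents_attr: "represents (attr_fms k1 k2 \<chi> d n) (attr n)"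
proof (induction n)
  case 0
  have "fm_defines M Fls k2 {}" by (rule fm_definesI) simp_all
  then show ?case using locs_eq by (simp add: represents_def attr_fms_def image_image)
next
  case (Suc n)
  then show ?case using represents_cpre[OF Suc] by (simp add: attr_fms_def)
qed

lemma closed_in_Th:
  assumes "wf_fm M \<phi>" and "fv_fm \<phi> = {}"
  shows "\<phi> \<in> Th M \<longleftrightarrow> sat M e \<phi>"
proof -
  have "sat M e \<phi> \<longleftrightarrow> sat M e' \<phi>" for e' using assms(2) by (intro sat_cong) simp
  then show ?thesis using assms unfolding Th_def by blast
qed

text \<open>Serves the final answer: with the singleton of the queried point as one of the sets, a
  nonempty intersection is membership.\<close>

lemma exb_in_Th:
  assumes "fm_defines M \<phi> k S" and "fm_defines M \<psi> k T"
  shows "exb 0 k (Conj \<phi> \<psi>) \<in> Th M \<longleftrightarrow> S \<inter> T \<noteq> {}"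
proof -
  have "exb 0 k (Conj \<phi> \<psi>) \<in> Th M \<longleftrightarrow> sat M e (exb 0 k (Conj \<phi> \<psi>))" for e
    using fm_definesD(1,2)[OF assms(1)] fm_definesD(1,2)[OF assms(2)] by (intro closed_in_Th) auto
  moreover have "sat M e (exb 0 k (Conj \<phi> \<psi>)) \<longleftrightarrow> (\<exists>xs. length xs = k \<and> xs \<in> S \<and> xs \<in> T)" for e
    unfolding sat_exb sat.simps sat_defines[OF assms(1)] sat_defines[OF assms(2)]
    using map_upd[of _ k e 0] by auto
  moreover have "length xs = k" if "xs \<in> S" for xs using fm_definesD(3)[OF assms(1)] that by blast
  ultimately show ?thesis by blast
qed

lemma grows_fm_in_Th: "Neg (grows_fm k1 k2 \<chi> d n) \<in> Th M \<longleftrightarrow> attr (Suc n) \<subseteq> attr n"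
proof -
  define \<phi> where "\<phi> m p = lookup (attr_fms k1 k2 \<chi> d m) (fst p)" for m and p :: "nat \<times> fm"
  have \<phi>: "fm_defines M (\<phi> m p) k2 {y. (fst p, y) \<in> attr m}" if "p \<in> set (d_locs d)" for m p
    unfolding \<phi>_def using that locs_eq by (intro lookup_defines[OF represents_attr]) blast
  have g: "grows_fm k1 k2 \<chi> d n = disjs (map (\<lambda>p. exb 0 k2 (Conj (\<phi> (Suc n) p) (Neg (\<phi> n p)))) (d_locs d))"
    by (simp add: grows_fm_def \<phi>_def)
  have "Neg (grows_fm k1 k2 \<chi> d n) \<in> Th M \<longleftrightarrow> sat M e (Neg (grows_fm k1 k2 \<chi> d n))" for e
    using fm_definesD(1,2)[OF \<phi>] unfolding g by (intro closed_in_Th) fastforce+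
  moreover have "sat M e (grows_fm k1 k2 \<chi> d n) \<longleftrightarrow> (\<exists>p\<in>set (d_locs d). \<exists>y. length y = k2 \<and>
      (fst p, y) \<in> attr (Suc n) \<and> (fst p, y) \<notin> attr n)" for e
  proof -
    have "sat M e (exb 0 k2 (Conj (\<phi> (Suc n) p) (Neg (\<phi> n p)))) \<longleftrightarrow>
        (\<exists>y. length y = k2 \<and> (fst p, y) \<in> attr (Suc n) \<and> (fst p, y) \<notin> attr n)"
      if p: "p \<in> set (d_locs d)" for p
      unfolding sat_exb sat.simps sat_defines[OF \<phi>[OF p]] using map_upd[of _ k2 e 0] by auto
    then show ?thesis by (simp add: g)
  qed
  moreover have "(\<exists>p\<in>set (d_locs d). \<exists>y. length y = k2 \<and> (fst p, y) \<in> attr (Suc n) \<and> (fst p, y) \<notin> attr n) \<longleftrightarrow>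
      \<not> attr (Suc n) \<subseteq> attr n"
  proof
    assume "\<not> attr (Suc n) \<subseteq> attr n"
    then obtain q y where qy: "(q, y) \<in> attr (Suc n)" "(q, y) \<notin> attr n" by auto
    then have "q \<in> locs A" "length y = k2" using attr_subset len2 by blast+
    moreover from this obtain p where "p \<in> set (d_locs d)" "fst p = q" using locs_eq by (metis imageE)
    ultimately show "\<exists>p\<in>set (d_locs d). \<exists>y. length y = k2 \<and> (fst p, y) \<in> attr (Suc n) \<and> (fst p, y) \<notin> attr n"
      using qy by auto
  qed blast
  ultimately show ?thesis by (metis sat.simps(4))
qed

end

section \<open>Computability of the attractor\<close>

lemma computable_list_decode: "computable list_decode"
proof (rule computable_from_enc)
  have "map enc (ns :: nat list) = ns" for ns by (simp add: enc_nat_def map_idI)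
  then have "(\<lambda>n. enc (list_decode n)) = (\<lambda>n. n)" by (simp add: enc_list_def)
  then show "computable (\<lambda>n. enc (list_decode n))" by (simp only:) (rule computable_ident)
qed

text \<open>Class instances for records are given on the extension type. The extension itself is
  left out of the code; for \<open>game_desc\<close> it is the unit type.\<close>

instantiation game_desc_ext :: (type) encodable
begin
definition enc_game_desc_ext :: "'a game_desc_scheme \<Rightarrow> nat" where
  "enc_game_desc_ext d = list_encode [enc (d_locs d), enc (d_goal d), enc (d_ctrl d), enc (d_unctrl d),
    list_encode (map trans_desc_code (d_trans d))]"
instance ..
end

lemma enc_loc_fm_list: "enc ws = loc_fm_list_code ws"
  by (simp add: enc_defs loc_fm_list_code_def case_prod_beta' cong: map_cong)

lemma enc_nat_list: "enc ns = list_encode (ns :: nat list)"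
  by (simp add: enc_list_def enc_nat_def map_idI)

lemma enc_game_desc: "enc d = game_code d"
  by (simp add: enc_game_desc_ext_def game_code_def enc_loc_fm_list enc_nat_list)

abbreviation (input) hd_code :: "nat \<Rightarrow> nat" where
  "hd_code n \<equiv> fst (prod_decode (n - 1))"

abbreviation (input) tl_code :: "nat \<Rightarrow> nat" where
  "tl_code n \<equiv> snd (prod_decode (n - 1))"

lemma computable_desc [computable_intros]:
  fixes f :: "'a::encodable \<Rightarrow> game_desc"
  assumes "computable f"
  shows "computable (\<lambda>x. d_locs (f x))" and "computable (\<lambda>x. d_goal (f x))"
    and "computable (\<lambda>x. d_ctrl (f x))" and "computable (\<lambda>x. d_unctrl (f x))"
proof -
  have "computable (d_locs :: game_desc \<Rightarrow> _)"
    by (rule computable_via_codes[where h = hd_code], intro computable_intros computable_prod_decode)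
      (simp add: enc_game_desc_ext_def)
  then show "computable (\<lambda>x. d_locs (f x))" by (rule computable_compose[OF assms])
  have "computable (d_goal :: game_desc \<Rightarrow> _)"
    by (rule computable_via_codes[where h = "\<lambda>n. hd_code (tl_code n)"],
        intro computable_intros computable_prod_decode)
      (simp add: enc_game_desc_ext_def)
  then show "computable (\<lambda>x. d_goal (f x))" by (rule computable_compose[OF assms])
  have "computable (d_ctrl :: game_desc \<Rightarrow> _)"
    by (rule computable_via_codes[where h = "\<lambda>n. hd_code (tl_code (tl_code n))"],
        intro computable_intros computable_prod_decode)
      (simp add: enc_game_desc_ext_def)
  then show "computable (\<lambda>x. d_ctrl (f x))" by (rule computable_compose[OF assms])
  have "computable (d_unctrl :: game_desc \<Rightarrow> _)"
    by (rule computable_via_codes[where h = "\<lambda>n. hd_code (tl_code (tl_code (tl_code n)))"],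
        intro computable_intros computable_prod_decode)
      (simp add: enc_game_desc_ext_def)
  then show "computable (\<lambda>x. d_unctrl (f x))" by (rule computable_compose[OF assms])
qed

text \<open>\<open>trans_desc_code\<close> codes a transition as a list of five numbers, while the
  tuple type is coded by nested pairs; \<open>tuple\<close> translates each entry on the level of
  numbers.\<close>

lemma computable_d_trans [computable_intros]:
  fixes f :: "'a::encodable \<Rightarrow> game_desc"
  assumes "computable f"
  shows "computable (\<lambda>x. d_trans (f x))"
proof -
  define tuple :: "nat \<Rightarrow> nat \<times> nat \<times> nat \<times> nat \<times> nat" where
    "tuple n = (hd_code n, hd_code (tl_code n), hd_code (tl_code (tl_code n)),
      hd_code (tl_code (tl_code (tl_code n))), hd_code (tl_code (tl_code (tl_code (tl_code n)))))" for n
  have tuple: "enc (tuple (trans_desc_code tr)) = enc tr" for tr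
    by (cases tr) (simp add: tuple_def trans_desc_code_def enc_defs)
  define h where "h n = enc (map tuple (list_decode (hd_code (tl_code (tl_code (tl_code (tl_code n)))))))" for n
  have "computable h"
    unfolding h_def tuple_def
    by (intro computable_intros computable_compose[OF _ computable_enc] computable_prod_decode
        computable_compose[OF _ computable_list_decode])
  moreover have "h (enc d) = enc (d_trans d)" for d :: game_desc
    by (simp add: h_def enc_game_desc_ext_def enc_list_def tuple comp_def)
  ultimately have "computable (d_trans :: game_desc \<Rightarrow> _)" by (rule computable_via_codes)
  then show ?thesis by (rule computable_compose[OF assms])
qed

section \<open>Computability of the formula constructors\<close>

lemma computable_exb [computable_intros]: "computable f \<Longrightarrow> computable (\<lambda>x. exb b k (f x))"
  by (induction k) (auto intro: computable_Ex)

text \<open>The variables in \<open>vs\<close>, and with them all bounds inside \<open>inst\<close>,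
  are constants of the machine; only the formula is an input.\<close>

lemma computable_inst [computable_intros]: "computable f \<Longrightarrow> computable (\<lambda>x. inst vs (f x))"
  unfolding inst_def Let_def by (intro computable_intros)

lemma computable_disjs [computable_intros]: "computable f \<Longrightarrow> computable (\<lambda>x. disjs (f x))"
  unfolding disjs_def by (intro computable_intros)

lemma computable_binary:
  assumes "computable (\<lambda>z. h (fst z) (snd z))" and "computable f" and "computable g"
  shows "computable (\<lambda>x. h (f x) (g x))"
  using computable_compose[OF computable_Pair[OF assms(2,3)] assms(1)] by simp

lemma computable_lookup [computable_intros]:
  assumes "computable f" and "computable g"
  shows "computable (\<lambda>x. lookup (f x) (g x))"
  by (rule computable_binary[OF _ assms]) (unfold lookup_def, intro computable_intros)

lemma computable_neg_fms [computable_intros]: "computable f \<Longrightarrow> computable (\<lambda>x. neg_fms (f x))"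
  unfolding neg_fms_def by (intro computable_intros)

lemma computable_succ_fm [computable_intros]:
  assumes "computable d" and "computable F" and "computable q" and "computable a"
  shows "computable (\<lambda>x. succ_fm k2 (d x) (F x) (q x) (a x))"
proof -
  have "computable (\<lambda>z. succ_fm k2 (fst z) (fst (snd z)) (fst (snd (snd z))) (snd (snd (snd z))))"
    unfolding succ_fm_def by (intro computable_intros)
  moreover have "computable (\<lambda>x. (d x, F x, q x, a x))" by (intro computable_intros assms)
  ultimately show ?thesis using computable_compose by fastforce
qed

lemma computable_alive_fms [computable_intros]:
  "computable d \<Longrightarrow> computable (\<lambda>x. alive_fms k1 k2 (d x))"
  unfolding alive_fms_def by (intro computable_intros)

lemma computable_forces_fm [computable_intros]:
  assumes "computable d" and "computable F" and "computable q"
  shows "computable (\<lambda>x. forces_fm k1 k2 (d x) (F x) (q x))"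
proof -
  have "computable (\<lambda>z. forces_fm k1 k2 (fst z) (fst (snd z)) (snd (snd z)))"
    unfolding forces_fm_def by (intro computable_intros)
  moreover have "computable (\<lambda>x. (d x, F x, q x))" by (intro computable_intros assms)
  ultimately show ?thesis using computable_compose by fastforce
qed

lemma computable_unsafe_fm [computable_intros]:
  assumes "computable d" and "computable F" and "computable q"
  shows "computable (\<lambda>x. unsafe_fm k2 (d x) (F x) (q x))"
proof -
  have "computable (\<lambda>z. unsafe_fm k2 (fst z) (fst (snd z)) (snd (snd z)))"
    unfolding unsafe_fm_def by (intro computable_intros)
  moreover have "computable (\<lambda>x. (d x, F x, q x))" by (intro computable_intros assms)
  ultimately show ?thesis using computable_compose by fastforce
qed

lemma computable_good_fm [computable_intros]:
  "computable g \<Longrightarrow> computable f \<Longrightarrow> computable h \<Longrightarrow> computable (\<lambda>x. good_fm k1 k2 (g x) (f x) (h x))"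
  unfolding good_fm_def at_fm_def by (intro computable_intros)

lemma computable_cpre_fms [computable_intros]:
  assumes "computable d" and "computable F"
  shows "computable (\<lambda>x. cpre_fms k1 k2 \<chi> (d x) (F x))"
  by (rule computable_binary[OF _ assms]) (unfold cpre_fms_def, intro computable_intros)

lemma computable_attr_fms [computable_intros]:
  assumes "computable d" and "computable n"
  shows "computable (\<lambda>x. attr_fms k1 k2 \<chi> (d x) (n x))"
proof (rule computable_binary[OF _ assms])
  show "computable (\<lambda>z. attr_fms k1 k2 \<chi> (fst z) (snd z))"
    unfolding attr_fms_def
    by (rule computable_funpow[where step = "\<lambda>z. cpre_fms k1 k2 \<chi> (fst z)"]) (intro computable_intros)+
qed

lemma computable_grows_fm [computable_intros]:
  assumes "computable d" and "computable n"
  shows "computable (\<lambda>x. grows_fm k1 k2 \<chi> (d x) (n x))"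
  by (rule computable_binary[OF _ assms]) (unfold grows_fm_def, intro computable_intros)

text \<open>The pieces partition the whole space, so their finitely many definable slices at one
  location already cover \<open>V2\<close>.\<close>

lemma definable_V2:
  assumes "finite P" and "definable_partition M k2 V2 A P" and "q \<in> locs A"
  shows "definable M k2 V2"
proof -
  obtain ps where ps: "set ps = P" using finite_list[OF assms(1)] by blast
  have "\<forall>p\<in>P. \<exists>\<phi>. fm_defines M \<phi> k2 {y. (q, y) \<in> p}"
    using assms(2,3) unfolding definable_partition_def definable_def by blast
  then obtain \<phi> where \<phi>: "\<And>p. p \<in> P \<Longrightarrow> fm_defines M (\<phi> p) k2 {y. (q, y) \<in> p}"
    by (auto simp: bchoice_iff)
  have V2: "V2 = {y. \<exists>p\<in>P. (q, y) \<in> p}"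
    using assms(2,3) partition_onD1[of "locs A \<times> V2" P] unfolding definable_partition_def by blast
  have mem: "(q, y) \<in> p \<longleftrightarrow> length y = k2 \<and> sat M ((!) y) (\<phi> p)" if "p \<in> P" for p y
    using fm_definesD(3)[OF \<phi>[OF that]] by blast
  have "fm_defines M (disjs (map \<phi> ps)) k2 V2"
  proof (rule fm_definesI)
    show "wf_fm M (disjs (map \<phi> ps))" using fm_definesD(1)[OF \<phi>] ps by simp
    show "fv_fm (disjs (map \<phi> ps)) \<subseteq> {..<k2}" using fm_definesD(2)[OF \<phi>] ps by (simp add: UN_least)
    show "length y = k2" if "y \<in> V2" for y using that mem unfolding V2 by blast
    show "sat M ((!) y) (disjs (map \<phi> ps)) \<longleftrightarrow> y \<in> V2" if "length y = k2" for y
      using that mem ps unfolding V2 by simp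
  qed
  then show ?thesis unfolding definable_def by blast
qed

theorem theorem5p10:
  fixes M :: "'m::ordered_grp fo_struct"
    and k1 k2 :: nat
    and V1 V2 :: "'m list set" and V :: "'m set"
    and C :: "'m game set"
  assumes "\<forall>x\<in>V1. length x = k1" and "\<forall>y\<in>V2. length y = k2"
    and "decidable_theory M"
    and "\<forall>A\<in>C. is_game M k1 k2 V1 V V2 A"
    and "\<forall>A\<in>C. \<exists>P. finite P \<and> definable_partition M k2 V2 A P \<and>
      union_of_pieces P (goal A \<times> V2) \<and>
      suffix_stable V1 V V2 A P \<and>
      (\<forall>a\<in>actions A. stable_under_Pred V2 A P a)"
  shows "control_problem_decidable M k1 k2 V1 V V2 C \<and>
    winning_states_computable M k1 k2 V1 V V2 C"
proof -
  \<comment> \<open>One formula must serve the whole class, since the machine may not depend on the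
    game; this is possible because \<open>V2\<close> is fixed. If no game of the class has a
    location, any formula will do.\<close>
  obtain \<chi> where \<chi>: "\<And>A. A \<in> C \<Longrightarrow> locs A \<noteq> {} \<Longrightarrow> fm_defines M \<chi> k2 V2"
  proof (cases "\<exists>A\<in>C. locs A \<noteq> {}")
    case True
    then have "definable M k2 V2" using assms(5) definable_V2 by (metis ex_in_conv)
    then show ?thesis using that unfolding definable_def by blast
  qed blast
  define stop where "stop d n \<longleftrightarrow> Neg (grows_fm k1 k2 \<chi> d n) \<in> Th M" for d n
  define steps where "steps d = (LEAST n. stop d n)" for d
  have correct: "described_game M k1 k2 V1 V V2 A d \<chi> \<and> (\<exists>n. stop d n) \<and>
      described_game.represents M k2 A (attr_fms k1 k2 \<chi> d (steps d)) (winning_states V1 V V2 A)"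
    if A: "A \<in> C" and d: "describes M k1 k2 V1 V V2 d A" for A d
  proof -
    interpret described_game M k1 k2 V1 V V2 A d \<chi>
      using assms(1,2,4) A d \<chi> by unfold_locales auto
    obtain P where P: "finite P" "definable_partition M k2 V2 A P" "suffix_stable V1 V V2 A P"
      "\<forall>a\<in>actions A. stable_under_Pred V2 A P a"
      using assms(5) A by blast
    interpret stable_game V1 V V2 A P
      using P by unfold_locales (auto simp: definable_partition_def)
    have stop: "stop d n \<longleftrightarrow> attr (Suc n) \<subseteq> attr n" for n
      unfolding stop_def by (rule grows_fm_in_Th)
    then have ex: "\<exists>n. stop d n" using attr_stabilises by blast
    then have "stop d (steps d)" unfolding steps_def by (rule LeastI_ex)
    then have "winning_states V1 V V2 A = attr (steps d)"
      using winning_states_eq_attr stop by blast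
    then show ?thesis using represents_attr ex described_game_axioms by simp
  qed
  have stop_computable: "computable (\<lambda>x. stop (f x) (g x))"
    if "computable f" and "computable g" for f :: "'a::encodable \<Rightarrow> game_desc" and g
    unfolding stop_def by (intro computable_Th[OF assms(3)] computable_intros that)
  have "control_problem_decidable M k1 k2 V1 V V2 C"
  proof -
    \<comment> \<open>Defined for all inputs and all \<open>n\<close>, so that it is a total
      computable predicate; its meaning matters only at the index where the search stops.\<close>
    define ans where "ans x n \<longleftrightarrow>
      exb 0 k2 (Conj (snd (snd x)) (lookup (attr_fms k1 k2 \<chi> (fst x) n) (fst (snd x)))) \<in> Th M"
      for x :: "game_desc \<times> nat \<times> fm" and n
    have "computable (\<lambda>p. stop (fst (fst p)) (snd p))"
      by (intro stop_computable computable_intros)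
    moreover have "computable (\<lambda>p. ans (fst p) (snd p))"
      unfolding ans_def by (intro computable_Th[OF assms(3)] computable_intros)
    ultimately obtain r where r: "\<forall>x. (\<exists>n. stop (fst x) n) \<longrightarrow>
        computes r [enc x] (enc (ans x (LEAST n. stop (fst x) n)))"
      using computes_at_Least[of "\<lambda>x. stop (fst x)" ans] by blast
    \<comment> \<open>Packs the three separate inputs into the nested pair that a unary machine
      expects.\<close>
    let ?f = "Comp r [Comp pair_recf [Proj 0, Comp pair_recf [Proj 1, Proj 2]]]"
    have "computes ?f [game_code d, q, fm_code \<phi>] (if (q, y) \<in> winning_states V1 V V2 A then 1 else 0)"
      if A: "A \<in> C" and d: "describes M k1 k2 V1 V V2 d A" and q: "q \<in> locs A" and y: "y \<in> V2"
        and \<phi>: "fm_defines M \<phi> k2 {y}" for A d q y \<phi>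
    proof -
      interpret described_game M k1 k2 V1 V V2 A d \<chi>
        using correct[OF A d] by blast
      have rep: "represents (attr_fms k1 k2 \<chi> d (steps d)) (winning_states V1 V V2 A)"
        using correct[OF A d] by blast
      have "ans (d, q, \<phi>) (steps d) \<longleftrightarrow> (q, y) \<in> winning_states V1 V V2 A"
        unfolding ans_def fst_conv snd_conv exb_in_Th[OF \<phi> lookup_defines[OF rep q]] by blast
      moreover have "computes r [prod_encode (game_code d, prod_encode (q, fm_code \<phi>))]
          (enc (ans (d, q, \<phi>) (steps d)))"
        using r[rule_format, of "(d, q, \<phi>)"] correct[OF A d]
        by (simp add: steps_def enc_prod_def enc_game_desc enc_nat_def enc_fm_def)
      moreover have "computes (Comp pair_recf [Proj 0, Comp pair_recf [Proj 1, Proj 2]])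
          [game_code d, q, fm_code \<phi>] (prod_encode (game_code d, prod_encode (q, fm_code \<phi>)))"
        by (rule computes_Comp2[OF computes_Proj
              computes_Comp2[OF computes_Proj computes_Proj computes_pair] computes_pair]) auto
      ultimately show ?thesis
        by (auto simp: enc_bool_def intro: computes_Comp1)
    qed
    then show ?thesis unfolding control_problem_decidable_def by blast
  qed
  moreover have "winning_states_computable M k1 k2 V1 V V2 C"
  proof -
    have "computable (\<lambda>p. stop (fst p) (snd p))"
      by (intro stop_computable computable_intros)
    moreover have "computable (\<lambda>p. attr_fms k1 k2 \<chi> (fst p) (snd p))"
      by (intro computable_intros)
    ultimately obtain r where r: "\<forall>d. (\<exists>n. stop d n) \<longrightarrow>
        computes r [enc d] (enc (attr_fms k1 k2 \<chi> d (LEAST n. stop d n)))"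
      using computes_at_Least[of stop "attr_fms k1 k2 \<chi>"] by blast
    have "\<exists>ws. computes r [game_code d] (loc_fm_list_code ws) \<and> fst ` set ws = locs A \<and>
        (\<forall>(q, \<phi>)\<in>set ws. fm_defines M \<phi> k2 {y. (q, y) \<in> winning_states V1 V V2 A})"
      if A: "A \<in> C" and d: "describes M k1 k2 V1 V V2 d A" for A d
    proof -
      interpret described_game M k1 k2 V1 V V2 A d \<chi>
        using correct[OF A d] by blast
      have rep: "represents (attr_fms k1 k2 \<chi> d (steps d)) (winning_states V1 V V2 A)"
        using correct[OF A d] by blast
      have "computes r [game_code d] (loc_fm_list_code (attr_fms k1 k2 \<chi> d (steps d)))"
        using r correct[OF A d] by (simp add: enc_loc_fm_list enc_game_desc steps_def)
      then show ?thesis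
        using rep unfolding represents_def by (intro exI[of _ "attr_fms k1 k2 \<chi> d (steps d)"]) auto
    qed
    then show ?thesis unfolding winning_states_computable_def by blast
  qed
  ultimately show ?thesis by blast
qed

end
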